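(* Suppose that $p=p(n)$ and $\omega \log n \le d=pn \le n / \omega = o(n)$, where $\omega=\omega(n)$ is any function tending to infinity as $n \to \infty$ such that $\omega \le \log n$. Let $i=i(n) \in \mathbb{N}$ be the largest integer such that $d^i = o(n)$. Suppose that $d^{i+1} / n - 2 \log n \to \infty$. Then the following property holds asymptotically almost surely for $G = (V,E) \in \mathcal{G}(n,p)$: $$ \mathrm{pq}(G) \le (2+o(1)) \frac {n \log n}{d^i} = O \left( \frac {n \log n}{d^i} \right). $$
   Context: Query game on a simple graph $G=(V,E)$: $d_G(u,v)$ denotes the graph distance. An adversary fixes a target vertex $v^*\in V$ unknown to an adaptive algorithm. In each round the algorithm makes a pair query, i.e. selects two arbitrary vertices $u,v\in V$, and the adversary replies with whichever of $u,v$ is closer to $v^*$ (with either one, at the adversary's choice, if $d_G(u,v^* )=d_G(v,v^* )$). Equivalently: put $V_0=V$; in round $t$ the algorithm presents $(u_t,v_t)$ (depending on $G$ and earlier replies) and the adversary chooses either $V_t=\{x\in V_{t-1}: d_G(u_t,x)\le d_G(v_t,x)\}$ (reply $u_t$) or $V_t=\{x\in V_{t-1}: d_G(v_t,x)\le d_G(u_t,x)\}$ (reply $v_t$); the target is located once $|V_t|=1$. $\mathrm{pq}(G)$ is the least integer $t$ such that the algorithm can locate the target in at most $t$ pair queries, regardless of the strategy of the adversary. $\mathcal{G}(n,p)$ is the binomial random graph on vertex set $\{1,\dots,n\}$, each pair being an edge independently with probability $p=p(n)$. A property holds asymptotically almost surely (a.a.s.) if its probability tends to $1$ as $n\to\infty$.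 $\log$ is the natural logarithm, $\mathbb{N}=\{1,2,\dots\}$, and asymptotic notation is as $n\to\infty$. Here $o(1)$ denotes some deterministic function of $n$ tending to $0$. *)

theory Defs
  imports "HOL-Probability.Probability" "HOL-Library.Landau_Symbols" "HOL-Library.Extended_Nat"
begin

text \<open>A simple graph is a vertex set together with a set of two-element sets of vertices.\<close>

definition all_edges :: "'a set \<Rightarrow> 'a set set" where
  "all_edges V = {e. e \<subseteq> V \<and> card e = 2}"

definition adj_rel :: "'a set set \<Rightarrow> ('a \<times> 'a) set" where
  "adj_rel E = {(x, y). {x, y} \<in> E}"

text \<open>The least length of a walk, which is infinity if the vertices are not connected.\<close>

definition graph_dist :: "'a set set \<Rightarrow> 'a \<Rightarrow> 'a \<Rightarrow> enat" where
  "graph_dist E u v = (INF k \<in> {k. (u, v) \<in> adj_rel E ^^ k}. enat k)"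

text \<open>An algorithm maps the list of replies received so far (in chronological order) to the next
  query \<open>(u, v)\<close>. The reply \<open>True\<close> stands for \<open>u\<close>, the reply \<open>False\<close> for \<open>v\<close>; the reply to the
  query of round \<open>t + 1\<close> is \<open>r t\<close>. Then \<open>candidates V E alg r t\<close> is the set \<open>V\<^sub>t\<close>.\<close>

type_synonym 'a algo = "bool list \<Rightarrow> 'a \<times> 'a"

primrec candidates :: "'a set \<Rightarrow> 'a set set \<Rightarrow> 'a algo \<Rightarrow> (nat \<Rightarrow> bool) \<Rightarrow> nat \<Rightarrow> 'a set" where
  "candidates V E alg r 0 = V"
| "candidates V E alg r (Suc t) =
     (case alg (map r [0..<t]) of (u, v) \<Rightarrow>
        {x \<in> candidates V E alg r t.
           if r t then graph_dist E u x \<le> graph_dist E v x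
                  else graph_dist E v x \<le> graph_dist E u x})"

text \<open>The premise \<open>\<forall>s. target \<in> candidates V E alg r s\<close> says precisely that the replies \<open>r\<close> are
  truthful for \<open>target\<close>. In particular the adversary may never make the candidate set empty.\<close>

definition locates_within :: "'a set \<Rightarrow> 'a set set \<Rightarrow> 'a algo \<Rightarrow> nat \<Rightarrow> bool" where
  "locates_within V E alg t \<longleftrightarrow>
     (\<forall>target \<in> V. \<forall>r. (\<forall>s. target \<in> candidates V E alg r s) \<longrightarrow>
        (\<exists>s\<le>t. card (candidates V E alg r s) = 1))"

definition pq :: "'a set \<Rightarrow> 'a set set \<Rightarrow> nat" where
  "pq V E = (LEAST t. \<exists>alg. (\<forall>h. alg h \<in> V \<times> V) \<and> locates_within V E alg t)"

definition gnp :: "nat \<Rightarrow> real \<Rightarrow> nat set set pmf" where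
  "gnp n p = map_pmf (\<lambda>f. {e \<in> all_edges {1..n}. f e})
     (Pi_pmf (all_edges {1..n}) False (\<lambda>_. bernoulli_pmf p))"

definition aas :: "(nat \<Rightarrow> real) \<Rightarrow> (nat \<Rightarrow> nat set set \<Rightarrow> bool) \<Rightarrow> bool" where
  "aas p P \<longleftrightarrow> (\<lambda>n. measure_pmf.prob (gnp n (p n)) {E. P n E}) \<longlonglongrightarrow> 1"

text \<open>Since \<open>d\<^sup>i = o(n)\<close> is a condition on the whole function \<open>i\<close> rather than on a single value
  \<open>i n\<close>, being the largest means eventually dominating every function that satisfies it.\<close>

definition largest_exponent :: "(nat \<Rightarrow> real) \<Rightarrow> (nat \<Rightarrow> nat) \<Rightarrow> bool" where
  "largest_exponent d i \<longleftrightarrow>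
     (\<forall>\<^sub>F n in sequentially. 1 \<le> i n) \<and>
     (\<lambda>n. d n ^ i n) \<in> o(\<lambda>n. real n) \<and>
     (\<forall>j :: nat \<Rightarrow> nat. (\<lambda>n. d n ^ j n) \<in> o(\<lambda>n. real n) \<longrightarrow>
        (\<forall>\<^sub>F n in sequentially. j n \<le> i n))"

end

theory Submission
  imports Defs
begin

text \<open>Write \<open>s = d\<^sup>i\<close> and let \<open>S x\<close> be the ball of radius \<open>i\<close> around \<open>x\<close>. Exploring the graph layer
  by layer and bounding the exponential moments of the layer sizes shows that a.a.s. every ball has size
  close to \<open>s\<close> and every union of two balls has size close to \<open>2 s\<close>, so two distinct balls have a
  negligible intersection. Given a candidate set \<open>W\<close> of size at least \<open>1000\<close>, double counting and the
  Cauchy-Schwarz inequality then yield a pair \<open>u, v\<close> such that \<open>S u - S v\<close> and \<open>S v - S u\<close> both contain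
  a fraction of at least \<open>3 s / (5 n)\<close> of \<open>W\<close>; the reply \<open>v\<close> eliminates the former, the reply \<open>u\<close> the
  latter. Asking such pairs, and finally pairs of candidates, takes at most
  \<open>5 n ln n / (3 s) + 1001 \<le> 2 n ln n / s\<close> queries.\<close>

subsection \<open>The query game\<close>

text \<open>The candidate sets depend on the graph through the earlier replies, so randomness may
  enter only through a property that does not mention them. Sizes of balls and of unions of two
  balls are enough: they control the first and second moment of \<open>card (W \<inter> S u)\<close>
  for all \<open>W\<close> at once. Unions are estimated instead of intersections because a union of
  two balls is again an exploration, merely started from two vertices. Exponential moments fit the
  layered exposure. Given the explored part, the size of the next layer is binomial, so a rate on
  the next layer becomes a rate on the present one, and concentration reduces to a scalar recursion
  for these rates. The fraction 3/5 exceeds 1/2, which is what the leading constant 2 requires; the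
  slack allows every error to be a fixed small percentage.\<close>

lemma sum_card_filter_swap:
  assumes "finite A" "finite B"
  shows "(\<Sum>a\<in>A. card {b\<in>B. R a b}) = (\<Sum>b\<in>B. card {a\<in>A. R a b})"
proof -
  have "(\<Sum>a\<in>A. card {b\<in>B. R a b}) = (\<Sum>a\<in>A. \<Sum>b\<in>B. if R a b then 1 else 0)"
    using assms by (simp add: sum.inter_filter[symmetric])
  also have "\<dots> = (\<Sum>b\<in>B. \<Sum>a\<in>A. if R a b then 1 else 0)"
    by (rule sum.swap)
  also have "\<dots> = (\<Sum>b\<in>B. card {a\<in>A. R a b})"
    using assms by (simp add: sum.inter_filter[symmetric])
  finally show ?thesis .
qed

text \<open>If every pair fails, all vertices whose balls meet \<open>W\<close> in nearly the
  average amount overlap heavily with one fixed ball. There are then only O(s) of them, yet they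
  carry a constant share of the incidences with \<open>W\<close>, too much for the second moment.
  The bound 1000 on \<open>card W\<close> keeps the diagonal part of that moment below the codegree
  part.\<close>

lemma balanced_pair_exists:
  fixes S :: "'a \<Rightarrow> 'a set" and s :: real
  assumes V: "finite V" and W: "W \<subseteq> V" and S: "\<And>x. x \<in> V \<Longrightarrow> S x \<subseteq> V"
    and sym: "\<And>x y. x \<in> V \<Longrightarrow> y \<in> V \<Longrightarrow> y \<in> S x \<longleftrightarrow> x \<in> S y"
    and lower: "\<And>x. x \<in> V \<Longrightarrow> 999/1000 * s \<le> card (S x)"
    and upper: "\<And>x. x \<in> V \<Longrightarrow> card (S x) \<le> 1001/1000 * s"
    and codegree: "\<And>x y. x \<in> V \<Longrightarrow> y \<in> V \<Longrightarrow> x \<noteq> y \<Longrightarrow> card (S x \<inter> S y) \<le> 4/1000 * s"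
    and s: "0 < s" and large: "1000 \<le> card W"
  shows "\<exists>u\<in>V. \<exists>v\<in>V. 3/5 * s * card W / card V \<le> card (W \<inter> (S u - S v)) \<and>
           3/5 * s * card W / card V \<le> card (W \<inter> (S v - S u))"
proof (rule ccontr)
  assume contra: "\<not> ?thesis"
  define m n where "m = real (card W)" and "n = real (card V)"
  define f where "f u = card (W \<inter> S u)" for u
  define b where "b = 3/5 * s * m / n"
  \<comment> \<open>\<open>a\<close> bounds the mean of \<open>f\<close> from below. Vertices under
    4/5 of it contribute at most \<open>4/5 * a * n\<close>, so a fifth of \<open>a * n\<close>
    remains on \<open>U\<close>. As \<open>b\<close> is about 3/5 of \<open>a\<close>, removing
    fewer than \<open>b\<close> elements from at least \<open>4/5 * a\<close> leaves more than a
    fifth of them.\<close>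
  define a where "a = 999/1000 * s * m / n"
  define U where "U = {u\<in>V. 4/5 * a \<le> real (f u)}"
  have fW: "finite W" using W V finite_subset by blast
  have m: "1000 \<le> m" using large by (simp add: m_def)
  have n: "m \<le> n" using W V by (simp add: m_def n_def card_mono)
  have n0: "0 < n" using m n by linarith
  have a0: "0 < a" unfolding a_def using s m n0 by (intro divide_pos_pos mult_pos_pos) auto
  have b0: "0 < b" unfolding b_def using s m n0 by (intro divide_pos_pos mult_pos_pos) auto
  have ba: "b = 3/5 * (1000/999) * a" unfolding a_def b_def by simp
  have fU: "finite U" using V by (simp add: U_def)
  have sum_f: "999/1000 * s * m \<le> (\<Sum>u\<in>V. real (f u))"
  proof -
    have "(\<Sum>u\<in>V. f u) = (\<Sum>u\<in>V. card {x\<in>W. x \<in> S u})"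
      by (simp add: f_def Int_def)
    also have "\<dots> = (\<Sum>x\<in>W. card {u\<in>V. x \<in> S u})"
      by (rule sum_card_filter_swap[OF V fW])
    also have "\<dots> = (\<Sum>x\<in>W. card (S x))"
    proof (rule sum.cong[OF refl])
      fix x assume "x \<in> W"
      then have "{u\<in>V. x \<in> S u} = S x" using W S sym by blast
      then show "card {u\<in>V. x \<in> S u} = card (S x)" by simp
    qed
    finally have "real (\<Sum>u\<in>V. f u) = real (\<Sum>x\<in>W. card (S x))" by simp
    then have "(\<Sum>u\<in>V. real (f u)) = (\<Sum>x\<in>W. real (card (S x)))" by simp
    moreover have "(\<Sum>x\<in>W. 999/1000 * s) \<le> (\<Sum>x\<in>W. real (card (S x)))"
      using lower W by (intro sum_mono) auto
    ultimately show ?thesis by (simp add: m_def mult.commute)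
  qed
  \<comment> \<open>The sum counts a centre together with an ordered pair from \<open>W\<close>.
    Diagonal pairs are charged a full ball, and all pairs the codegree bound.\<close>
  have sum_f2: "(\<Sum>u\<in>V. (real (f u))\<^sup>2) \<le> m * (1001/1000 * s) + m^2 * (4/1000 * s)"
  proof -
    have "(\<Sum>u\<in>V. (f u)\<^sup>2) = (\<Sum>u\<in>V. card {z\<in>W \<times> W. fst z \<in> S u \<and> snd z \<in> S u})"
    proof (rule sum.cong[OF refl])
      fix u
      have "{z\<in>W \<times> W. fst z \<in> S u \<and> snd z \<in> S u} = (W \<inter> S u) \<times> (W \<inter> S u)" by auto
      then show "(f u)\<^sup>2 = card {z\<in>W \<times> W. fst z \<in> S u \<and> snd z \<in> S u}"
        by (simp only: f_def power2_eq_square card_cartesian_product)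
    qed
    also have "\<dots> = (\<Sum>z\<in>W \<times> W. card {u\<in>V. fst z \<in> S u \<and> snd z \<in> S u})"
      using V fW by (intro sum_card_filter_swap) auto
    also have "\<dots> = (\<Sum>z\<in>W \<times> W. card (S (fst z) \<inter> S (snd z)))"
    proof (rule sum.cong[OF refl])
      fix z assume "z \<in> W \<times> W"
      then have "fst z \<in> V" "snd z \<in> V" using W by auto
      then have "{u\<in>V. fst z \<in> S u \<and> snd z \<in> S u} = S (fst z) \<inter> S (snd z)"
        using S sym by blast
      then show "card {u\<in>V. fst z \<in> S u \<and> snd z \<in> S u} = card (S (fst z) \<inter> S (snd z))" by simp
    qed
    finally have "real (\<Sum>u\<in>V. (f u)\<^sup>2) = real (\<Sum>z\<in>W \<times> W. card (S (fst z) \<inter> S (snd z)))"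
      by simp
    then have "(\<Sum>u\<in>V. (real (f u))\<^sup>2) = (\<Sum>z\<in>W \<times> W. real (card (S (fst z) \<inter> S (snd z))))"
      by simp
    also have "\<dots> \<le> (\<Sum>z\<in>W \<times> W. (if fst z = snd z then 1001/1000 * s else 0) + 4/1000 * s)"
    proof (rule sum_mono)
      fix z assume "z \<in> W \<times> W"
      then have "fst z \<in> V" "snd z \<in> V" using W by auto
      then show "real (card (S (fst z) \<inter> S (snd z)))
          \<le> (if fst z = snd z then 1001/1000 * s else 0) + 4/1000 * s"
        using codegree[of "fst z" "snd z"] upper[of "fst z"] s by auto
    qed
    also have "\<dots> = m * (1001/1000 * s) + m^2 * (4/1000 * s)"
    proof -
      have "(\<Sum>z\<in>W \<times> W. if fst z = snd z then 1001/1000 * s else 0)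
          = (\<Sum>x\<in>W. \<Sum>y\<in>W. if x = y then 1001/1000 * s else 0)"
        by (subst sum.cartesian_product) (simp add: case_prod_beta)
      also have "\<dots> = m * (1001/1000 * s)"
        using fW by (simp add: sum.delta m_def)
      finally show ?thesis
        by (simp add: sum.distrib m_def power2_eq_square card_cartesian_product)
    qed
    finally show ?thesis .
  qed
  have sum_U: "a * n / 5 \<le> (\<Sum>u\<in>U. real (f u))"
  proof -
    have "(\<Sum>u\<in>V. real (f u)) = (\<Sum>u\<in>U. real (f u)) + (\<Sum>u\<in>V - U. real (f u))"
      using V by (subst sum.subset_diff[of U V]) (auto simp: U_def)
    moreover have "(\<Sum>u\<in>V - U. real (f u)) \<le> (\<Sum>u\<in>V - U. 4/5 * a)"
      by (intro sum_mono) (auto simp: U_def)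
    moreover have "(\<Sum>u\<in>V - U. 4/5 * a) \<le> 4/5 * a * n"
    proof -
      have "real (card (V - U)) \<le> n" unfolding n_def using V by (simp add: card_mono)
      then show ?thesis using a0 by (simp add: mult.commute)
    qed
    moreover have "a * n = 999/1000 * s * m" using n0 by (simp add: a_def)
    ultimately show ?thesis using sum_f by linarith
  qed
  moreover have "0 < a * n / 5" using a0 n0 by simp
  ultimately have "U \<noteq> {}" by auto
  then obtain u where u: "u \<in> U" "\<And>v. v \<in> U \<Longrightarrow> f u \<le> f v"
    using fU by (metis arg_min_if_finite(1) arg_min_least)
  have uV: "u \<in> V" "4/5 * a \<le> real (f u)" using u by (auto simp: U_def)
  have fu0: "0 < real (f u)" using uV a0 by linarith
  \<comment> \<open>No pair containing the minimiser \<open>u\<close> is good, so every ball around \<open>U\<close> contains a fifth of \<open>W \<inter> S u\<close>.\<close>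
  have overlap: "real (f u) / 5 \<le> real (card {x\<in>W \<inter> S u. x \<in> S v})" if v: "v \<in> U" for v
  proof -
    have vV: "v \<in> V" using v by (auto simp: U_def)
    have eq: "f w = card {x\<in>W \<inter> S u. x \<in> S v} + card (W \<inter> (S w - S w'))"
      if "(w, w') = (u, v) \<or> (w, w') = (v, u)" for w w'
    proof -
      have "W \<inter> S w = {x\<in>W \<inter> S u. x \<in> S v} \<union> (W \<inter> (S w - S w'))" using that by auto
      moreover have "{x\<in>W \<inter> S u. x \<in> S v} \<inter> (W \<inter> (S w - S w')) = {}" using that by auto
      ultimately show ?thesis using fW unfolding f_def
        by (metis (no_types, lifting) card_Un_disjoint finite_Int finite_Un)
    qed
    have eqs: "f u = card {x\<in>W \<inter> S u. x \<in> S v} + card (W \<inter> (S u - S v))"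
      "f v = card {x\<in>W \<inter> S u. x \<in> S v} + card (W \<inter> (S v - S u))"
      using eq[of u v] eq[of v u] by simp_all
    have "card (W \<inter> (S u - S v)) < b \<or> card (W \<inter> (S v - S u)) < b"
      using contra uV vV unfolding b_def m_def n_def by fastforce
    \<comment> \<open>Both balls share the same part of \<open>W\<close>, so minimality of
      \<open>f u\<close> decides which remainder is the small one.\<close>
    moreover have "card (W \<inter> (S u - S v)) \<le> card (W \<inter> (S v - S u))"
      using eqs u(2)[OF v] by linarith
    ultimately have "card (W \<inter> (S u - S v)) < b" by linarith
    then show ?thesis using eqs(1) uV(2) ba a0 by simp
  qed
  \<comment> \<open>Incidences between \<open>W \<inter> S u\<close> and \<open>U\<close> are
    counted from both sides: each \<open>v\<close> contains a fifth of that set in its ball, and by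
    symmetry each \<open>x\<close> lies in at most \<open>card (S x)\<close> balls.\<close>
  have cardU: "real (card U) \<le> 5 * (1001/1000) * s"
  proof -
    have "real (card U) * (real (f u) / 5) = (\<Sum>v\<in>U. real (f u) / 5)" by simp
    also have "\<dots> \<le> (\<Sum>v\<in>U. real (card {x\<in>W \<inter> S u. x \<in> S v}))"
      using overlap by (intro sum_mono) auto
    also have "\<dots> = real (\<Sum>x\<in>W \<inter> S u. card {v\<in>U. x \<in> S v})"
      using fW fU by (subst sum_card_filter_swap[symmetric]) auto
    also have "\<dots> = (\<Sum>x\<in>W \<inter> S u. real (card {v\<in>U. x \<in> S v}))" by simp
    also have "\<dots> \<le> (\<Sum>x\<in>W \<inter> S u. 1001/1000 * s)"
    proof (rule sum_mono)
      fix x assume "x \<in> W \<inter> S u"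
      then have x: "x \<in> V" using W by auto
      then have "{v\<in>U. x \<in> S v} \<subseteq> S x" using sym by (auto simp: U_def)
      moreover have "finite (S x)" using S[OF x] V finite_subset by blast
      ultimately have "card {v\<in>U. x \<in> S v} \<le> card (S x)" by (simp add: card_mono)
      then show "real (card {v\<in>U. x \<in> S v}) \<le> 1001/1000 * s" using upper[OF x] by linarith
    qed
    also have "\<dots> = real (f u) * (1001/1000 * s)" by (simp add: f_def)
    finally have "real (f u) * real (card U) \<le> real (f u) * (5 * (1001/1000) * s)"
      by (simp add: mult_ac)
    then show ?thesis using fu0 by (simp only: mult_le_cancel_left_pos)
  qed
  have "(a * n / 5)\<^sup>2 \<le> (\<Sum>u\<in>U. real (f u))\<^sup>2"
    using sum_U a0 n0 by (intro power_mono) auto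
  also have "\<dots> \<le> (\<Sum>u\<in>U. (real (f u))\<^sup>2) * real (card U)"
    by (rule sum_squared_le_sum_of_squares)
  also have "\<dots> \<le> (m * (1001/1000 * s) + m^2 * (4/1000 * s)) * (5 * (1001/1000) * s)"
  proof (rule mult_mono)
    have "(\<Sum>u\<in>U. (real (f u))\<^sup>2) \<le> (\<Sum>u\<in>V. (real (f u))\<^sup>2)"
      using V by (intro sum_mono2) (auto simp: U_def)
    then show "(\<Sum>u\<in>U. (real (f u))\<^sup>2) \<le> m * (1001/1000 * s) + m^2 * (4/1000 * s)"
      using sum_f2 by linarith
    show "0 \<le> m * (1001/1000 * s) + m^2 * (4/1000 * s)" using m s by simp
  qed (use cardU in auto)
  also have "\<dots> \<le> (m\<^sup>2 * (1001/1000000 * s) + m^2 * (4/1000 * s)) * (5 * (1001/1000) * s)"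
  proof -
    have "1000 * m \<le> m\<^sup>2" using m by (simp add: power2_eq_square)
    then have "m * (1001/1000 * s) \<le> m\<^sup>2 * (1001/1000000 * s)"
      using mult_right_mono[of "1000 * m" "m\<^sup>2" "1001/1000000 * s"] s by simp
    then show ?thesis using s by (intro mult_right_mono add_right_mono) auto
  qed
  also have "\<dots> = (m * s)\<^sup>2 * (5001/1000000 * (5005/1000))"
    by (simp add: power2_eq_square algebra_simps)
  \<comment> \<open>Numerically about 0.0250 against 0.0399.\<close>
  also have "\<dots> < (m * s)\<^sup>2 * (999/5000)\<^sup>2"
    using m s by (intro mult_strict_left_mono) (auto simp: power2_eq_square)
  also have "\<dots> = (a * n / 5)\<^sup>2"
    using n0 by (simp add: a_def power2_eq_square)
  finally show False by simp
qed

section \<open>Distances and the greedy strategy\<close>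

lemma graph_dist_le_iff: "graph_dist E u v \<le> enat i \<longleftrightarrow> (\<exists>k\<le>i. (u, v) \<in> adj_rel E ^^ k)"
proof
  assume le: "graph_dist E u v \<le> enat i"
  show "\<exists>k\<le>i. (u, v) \<in> adj_rel E ^^ k"
  proof (rule ccontr)
    assume "\<not> ?thesis"
    then have "enat (Suc i) \<le> graph_dist E u v"
      unfolding graph_dist_def by (intro INF_greatest) (auto simp: not_le Suc_le_eq)
    then have "enat (Suc i) \<le> enat i" using le by (rule order_trans)
    then show False by simp
  qed
next
  assume "\<exists>k\<le>i. (u, v) \<in> adj_rel E ^^ k"
  then obtain k where k: "k \<le> i" "(u, v) \<in> adj_rel E ^^ k" by blast
  then have "graph_dist E u v \<le> enat k" unfolding graph_dist_def by (intro INF_lower) auto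
  with k show "graph_dist E u v \<le> enat i" by (meson enat_ord_simps(1) order_trans)
qed

lemma graph_dist_commute: "graph_dist E u v = graph_dist E v u"
proof -
  have relpow_sym: "(v, u) \<in> adj_rel E ^^ k" if "(u, v) \<in> adj_rel E ^^ k" for k u v
    using that
  proof (induction k arbitrary: v)
    case (Suc k)
    then obtain w where "(u, w) \<in> adj_rel E ^^ k" "(w, v) \<in> adj_rel E" by auto
    moreover from this have "(v, w) \<in> adj_rel E" by (simp add: adj_rel_def insert_commute)
    ultimately show ?case using Suc.IH by (blast intro: relpow_Suc_I2)
  qed simp
  have "(u, v) \<in> adj_rel E ^^ k \<longleftrightarrow> (v, u) \<in> adj_rel E ^^ k" for k
    by (metis relpow_sym)
  then show ?thesis by (simp add: graph_dist_def)
qed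

text \<open>This drives the last queries: if both members of a pair are candidates, either reply
  eliminates the other member, even when the two are not connected.\<close>

lemma graph_dist_self_less:
  assumes "u \<noteq> v" shows "graph_dist E u u < graph_dist E v u"
proof -
  have "graph_dist E u u \<le> enat 0" by (subst graph_dist_le_iff) auto
  moreover have "\<not> graph_dist E v u \<le> enat 0" using assms by (subst graph_dist_le_iff) auto
  ultimately show ?thesis by (meson le_less_trans not_le)
qed

definition survivors :: "'a set set \<Rightarrow> 'a set \<Rightarrow> 'a \<Rightarrow> 'a \<Rightarrow> 'a set" where
  "survivors E W u v = {x \<in> W. graph_dist E u x \<le> graph_dist E v x}"

text \<open>A vertex in the ball of \<open>v\<close> but outside the ball of \<open>u\<close> is
  strictly closer to \<open>v\<close>, so the reply \<open>u\<close> removes it. Balls thereby stand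
  in for exact comparisons of distances.\<close>

lemma card_survivors_le:
  assumes "finite W"
  shows "card (survivors E W u v) + card {x\<in>W. graph_dist E v x \<le> enat i \<and> \<not> graph_dist E u x \<le> enat i}
      \<le> card W"
proof -
  let ?D = "{x\<in>W. graph_dist E v x \<le> enat i \<and> \<not> graph_dist E u x \<le> enat i}"
  have "survivors E W u v \<inter> ?D = {}" unfolding survivors_def by (auto dest: order_trans)
  moreover have "survivors E W u v \<union> ?D \<subseteq> W" by (auto simp: survivors_def)
  moreover have "finite (survivors E W u v)" "finite ?D" using assms by (auto simp: survivors_def)
  ultimately show ?thesis using assms by (metis (no_types, lifting) card_Un_disjoint card_mono)
qed

text \<open>An algorithm sees only the replies, whereas the strategy \<open>\<sigma>\<close> chooses
  from the current candidate set; the fold recovers that set from the replies.\<close>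

definition greedy_candidates :: "'a set \<Rightarrow> 'a set set \<Rightarrow> ('a set \<Rightarrow> 'a \<times> 'a) \<Rightarrow> bool list \<Rightarrow> 'a set" where
  "greedy_candidates V E \<sigma> =
     foldl (\<lambda>W b. case \<sigma> W of (u, v) \<Rightarrow> if b then survivors E W u v else survivors E W v u) V"

lemma candidates_greedy:
  "candidates V E (\<lambda>h. \<sigma> (greedy_candidates V E \<sigma> h)) r t = greedy_candidates V E \<sigma> (map r [0..<t])"
proof (induction t)
  case (Suc t)
  then show ?case
    by (cases "\<sigma> (greedy_candidates V E \<sigma> (map r [0..<t]))")
      (auto simp: greedy_candidates_def survivors_def)
qed (simp add: greedy_candidates_def)

text \<open>Two regimes are charged separately: geometric decay down to \<open>m\<^sub>0\<close>
  candidates, and then at least one candidate lost per query, because a pair of candidates can be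
  asked.\<close>

lemma pq_le_of_shrinking_queries:
  fixes \<theta> :: real and m\<^sub>0 :: nat
  assumes V: "finite V" "V \<noteq> {}" and \<theta>: "0 < \<theta>" "\<theta> \<le> 1" and m0: "2 \<le> m\<^sub>0"
    and shrink: "\<And>W. W \<subseteq> V \<Longrightarrow> m\<^sub>0 \<le> card W \<Longrightarrow> \<exists>u\<in>V. \<exists>v\<in>V.
      card (survivors E W u v) \<le> (1 - \<theta>) * card W \<and> card (survivors E W v u) \<le> (1 - \<theta>) * card W"
  shows "pq V E \<le> m\<^sub>0 + nat \<lceil>ln (card V) / \<theta>\<rceil>"
proof -
  define good where "good W z \<longleftrightarrow> z \<in> V \<times> V \<and>
     (2 \<le> card W \<longrightarrow> card (survivors E W (fst z) (snd z)) < card W \<and>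
        card (survivors E W (snd z) (fst z)) < card W) \<and>
     (m\<^sub>0 \<le> card W \<longrightarrow> card (survivors E W (fst z) (snd z)) \<le> (1 - \<theta>) * card W \<and>
        card (survivors E W (snd z) (fst z)) \<le> (1 - \<theta>) * card W)" for W z
  have good_ex: "\<exists>z. good W z" if W: "W \<subseteq> V" for W
  proof -
    have fW: "finite W" using W V finite_subset by blast
    consider "m\<^sub>0 \<le> card W" | "card W < m\<^sub>0" "2 \<le> card W" | "card W < 2" by linarith
    then show ?thesis
    proof cases
      case 1
      then obtain u v where uv: "u \<in> V" "v \<in> V" "card (survivors E W u v) \<le> (1 - \<theta>) * card W"
        "card (survivors E W v u) \<le> (1 - \<theta>) * card W" using shrink[OF W] by blast
      have "(1 - \<theta>) * card W < card W" using 1 m0 \<theta> by (simp add: algebra_simps)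
      then have "good W (u, v)" using uv unfolding good_def by auto
      then show ?thesis ..
    next
      case 2
      then obtain u v where uv: "u \<in> W" "v \<in> W" "u \<noteq> v"
        by (meson card_2_iff' obtain_subset_with_card_n subset_iff)
      have "survivors E W u v \<subset> W" "survivors E W v u \<subset> W"
        using uv graph_dist_self_less[of u v E] graph_dist_self_less[of v u E]
        unfolding survivors_def by (auto simp: not_le[symmetric] psubset_eq)
      then have "card (survivors E W u v) < card W" "card (survivors E W v u) < card W"
        using fW psubset_card_mono by blast+
      then have "good W (u, v)" using uv W 2 unfolding good_def by auto
      then show ?thesis ..
    next
      case 3
      obtain u where "u \<in> V" using V by blast
      then have "good W (u, u)" using 3 m0 unfolding good_def by auto
      then show ?thesis ..
    qed
  qed
  obtain z\<^sub>0 where z0: "z\<^sub>0 \<in> V" using V by blast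
  \<comment> \<open>Since \<open>good\<close> demands a strict decrease as well as the geometric
    one, a single choice function serves both regimes. The default pair makes every value of
    \<open>\<sigma>\<close> a legal query.\<close>
  define \<sigma> where "\<sigma> W = (if W \<subseteq> V then SOME z. good W z else (z\<^sub>0, z\<^sub>0))" for W
  have \<sigma>: "good W (\<sigma> W)" if "W \<subseteq> V" for W
    using someI_ex[OF good_ex[OF that]] that by (simp add: \<sigma>_def)
  have \<sigma>V: "\<sigma> W \<in> V \<times> V" for W
    using \<sigma>[of W] z0 by (cases "W \<subseteq> V") (auto simp: good_def \<sigma>_def)
  define alg where "alg h = \<sigma> (greedy_candidates V E \<sigma> h)" for h
  define T where "T = nat \<lceil>ln (card V) / \<theta>\<rceil>"
  have "locates_within V E alg (m\<^sub>0 + T)"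
    unfolding locates_within_def
  proof (intro ballI allI impI)
    fix x r assume x: "x \<in> V" and tr: "\<forall>t. x \<in> candidates V E alg r t"
    define C where "C t = candidates V E alg r t" for t
    have CV: "C t \<subseteq> V" for t
      unfolding C_def by (induction t) (auto split: prod.split)
    have C_Suc: "C (Suc t) = (if r t then survivors E (C t) (fst (\<sigma> (C t))) (snd (\<sigma> (C t)))
        else survivors E (C t) (snd (\<sigma> (C t))) (fst (\<sigma> (C t))))" for t
      unfolding C_def alg_def candidates_greedy
      by (simp add: greedy_candidates_def case_prod_beta)
    have decr: "card (C (Suc t)) < card (C t)" if "2 \<le> card (C t)" for t
      using \<sigma>[OF CV[of t]] that C_Suc[of t] by (simp add: good_def)
    have shr: "card (C (Suc t)) \<le> (1 - \<theta>) * card (C t)" if "m\<^sub>0 \<le> card (C t)" for t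
      using \<sigma>[OF CV[of t]] that C_Suc[of t] by (simp add: good_def)
    show "\<exists>s\<le>m\<^sub>0 + T. card (candidates V E alg r s) = 1"
    proof (rule ccontr)
      assume "\<not> ?thesis"
      then have ne1: "card (C s) \<noteq> 1" if "s \<le> m\<^sub>0 + T" for s using that by (auto simp: C_def)
      \<comment> \<open>The target always survives, so a set that is never a singleton keeps at
        least two elements.\<close>
      have "0 < card (C s)" for s
        using tr CV[of s] V finite_subset[OF CV[of s]] unfolding C_def by (auto simp: card_gt_0_iff)
      then have ge2: "2 \<le> card (C s)" if "s \<le> m\<^sub>0 + T" for s
        using ne1[OF that] by (metis One_nat_def Suc_leI le_neq_implies_less numeral_2_eq_2)
      \<comment> \<open>The first alternative is stable because the sizes decrease strictly. At
        exactly \<open>m\<^sub>0\<close> the strict decrease is needed, as the exponential bound may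
        not be available there.\<close>
      have phase1: "card (C s) \<le> m\<^sub>0 \<or> card (C s) \<le> (1 - \<theta>) ^ s * card V" if "s \<le> m\<^sub>0 + T" for s
        using that
      proof (induction s)
        case (Suc s)
        show ?case
        proof (cases "m\<^sub>0 \<le> card (C s)")
          case True
          have c: "card (C (Suc s)) \<le> (1 - \<theta>) * card (C s)" using shr[OF True] .
          have d: "card (C (Suc s)) < card (C s)" using decr ge2[of s] Suc by simp
          show ?thesis
          proof (cases "card (C s) = m\<^sub>0")
            case True
            with d show ?thesis by simp
          next
            case False
            then have "card (C s) \<le> (1 - \<theta>) ^ s * card V" using Suc True by auto
            then have "(1 - \<theta>) * card (C s) \<le> (1 - \<theta>) * ((1 - \<theta>) ^ s * card V)"
              using \<theta> by (intro mult_left_mono) auto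
            then show ?thesis using c by (simp add: mult_ac)
          qed
        next
          case False
          then show ?thesis using decr[of s] ge2[of s] Suc by auto
        qed
      qed (simp add: C_def)
      have "(1 - \<theta>) ^ T * card V \<le> 1"
      proof -
        have "(1 - \<theta>) ^ T \<le> exp (- \<theta>) ^ T"
          using exp_ge_add_one_self[of "-\<theta>"] \<theta> by (intro power_mono) auto
        also have "\<dots> = exp (- (\<theta> * T))" by (simp add: exp_of_nat_mult[symmetric] mult.commute)
        also have "\<dots> \<le> exp (- ln (card V))"
        proof -
          have "ln (card V) / \<theta> \<le> T" unfolding T_def by linarith
          then show ?thesis using \<theta> by (simp add: field_simps)
        qed
        also have "\<dots> = 1 / card V" using V by (simp add: exp_minus card_gt_0_iff inverse_eq_divide)
        finally show ?thesis using V by (simp add: field_simps card_gt_0_iff)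
      qed
      then have T: "card (C T) \<le> m\<^sub>0" using phase1[of T] ge2[of T] m0 by force
      \<comment> \<open>At \<open>k = m\<^sub>0\<close> no candidate would be left, against
        \<open>ge2\<close>.\<close>
      have phase2: "card (C (T + k)) + k \<le> m\<^sub>0" if "k \<le> m\<^sub>0" for k
        using that
      proof (induction k)
        case (Suc k)
        then show ?case using decr[of "T + k"] ge2[of "T + k"] by simp
      qed (simp add: T)
      then show False using phase2[of m\<^sub>0] ge2[of "T + m\<^sub>0"] by simp
    qed
  qed
  moreover have "\<forall>h. alg h \<in> V \<times> V" using \<sigma>V by (simp add: alg_def)
  ultimately show ?thesis unfolding pq_def T_def by (intro Least_le) blast
qed

subsection \<open>Exploring a random graph\<close>

lemma finite_set_Pi_pmf_bool:
  fixes P :: "'a \<Rightarrow> bool pmf"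
  assumes "finite A" shows "finite (set_pmf (Pi_pmf A False P))"
  using assms by (simp add: set_Pi_pmf finite_PiE_dflt)

lemma integrable_Pi_pmf_bool [simp]:
  fixes P :: "'a \<Rightarrow> bool pmf" and h :: "_ \<Rightarrow> real"
  assumes "finite A" shows "integrable (measure_pmf (Pi_pmf A False P)) h"
  using finite_set_Pi_pmf_bool[OF assms] by (rule integrable_measure_pmf_finite)

text \<open>Fubini for independent bits: the coordinates in \<open>B\<close> are exposed first. It
  replaces conditioning on a partially exposed graph.\<close>

lemma expectation_Pi_pmf_split:
  fixes P :: "'a \<Rightarrow> bool pmf" and h :: "_ \<Rightarrow> real"
  assumes A: "finite A" and B: "B \<subseteq> A"
  shows "measure_pmf.expectation (Pi_pmf A False P) h =
    measure_pmf.expectation (Pi_pmf B False P) (\<lambda>f.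
      measure_pmf.expectation (Pi_pmf (A - B) False P) (\<lambda>g. h (\<lambda>x. if x \<in> B then f x else g x)))"
proof -
  let ?f = "\<lambda>f. bind_pmf (Pi_pmf (A - B) False P) (\<lambda>g. return_pmf (\<lambda>x. if x \<in> B then f x else g x))"
  have fin: "finite B" "finite (A - B)" using A B finite_subset by auto
  have eq: "Pi_pmf A False P = bind_pmf (Pi_pmf B False P) ?f"
  proof -
    have "Pi_pmf (B \<union> (A - B)) False P = bind_pmf (Pi_pmf B False P) ?f"
      using fin by (subst Pi_pmf_union)
        (auto simp: map_pmf_def pair_pmf_def bind_assoc_pmf bind_return_pmf)
    moreover have "B \<union> (A - B) = A" using B by auto
    ultimately show ?thesis by simp
  qed
  have "measure_pmf.expectation (Pi_pmf A False P) h = (\<Sum>f\<in>set_pmf (Pi_pmf B False P).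
      pmf (Pi_pmf B False P) f *\<^sub>R measure_pmf.expectation (?f f) h)"
    unfolding eq using fin by (intro pmf_expectation_bind)
      (auto simp: finite_set_Pi_pmf_bool)
  also have "\<dots> = measure_pmf.expectation (Pi_pmf B False P) (\<lambda>f. measure_pmf.expectation (?f f) h)"
    using fin by (subst integral_measure_pmf[where A = "set_pmf (Pi_pmf B False P)"])
      (auto simp: finite_set_Pi_pmf_bool)
  finally show ?thesis by (simp add: map_pmf_def[symmetric])
qed

lemma prob_Pi_pmf_bernoulli_none:
  assumes "finite C" "K \<subseteq> C" "0 \<le> p" "p \<le> 1"
  shows "measure_pmf.prob (Pi_pmf C False (\<lambda>_. bernoulli_pmf p)) {f. \<forall>e\<in>K. \<not> f e} = (1 - p) ^ card K"
proof -
  have "{f. \<forall>e\<in>K. \<not> f e} = Pi C (\<lambda>e. if e \<in> K then {False} else UNIV)"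
    using assms by (auto simp: Pi_def)
  then have "measure_pmf.prob (Pi_pmf C False (\<lambda>_. bernoulli_pmf p)) {f. \<forall>e\<in>K. \<not> f e}
      = (\<Prod>e\<in>C. measure_pmf.prob (bernoulli_pmf p) (if e \<in> K then {False} else UNIV))"
    using assms by (simp add: measure_Pi_pmf_Pi)
  also have "\<dots> = (\<Prod>e\<in>C. if e \<in> K then 1 - p else 1)"
    using assms by (intro prod.cong) (auto simp: measure_pmf_single)
  also have "\<dots> = (1 - p) ^ card K"
    using assms by (simp add: prod.If_cases Int_absorb1)
  finally show ?thesis .
qed

section \<open>Layers and the exploration process\<close>

definition neighbours_in :: "('a set \<Rightarrow> bool) \<Rightarrow> 'a set \<Rightarrow> 'a set \<Rightarrow> 'a set" where
  "neighbours_in f F Y = {y\<in>Y. \<exists>x\<in>F. f {x, y}}"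

lemma neighbours_in_cong:
  assumes "\<And>x y. x \<in> F \<Longrightarrow> y \<in> Y \<Longrightarrow> f {x, y} = g {x, y}"
  shows "neighbours_in f F Y = neighbours_in g F Y"
  using assms unfolding neighbours_in_def by blast

text \<open>Different vertices of \<open>Y\<close> depend on disjoint sets of edges to
  \<open>F\<close>, so the number of vertices hit is binomial with success probability
  \<open>1 - (1 - p) ^ card F\<close>; the right-hand side is its moment generating function. A
  general \<open>C\<close> lets the induction remove the edges of one vertex at a time.\<close>

lemma expectation_exp_card_neighbours_in:
  fixes c p :: real
  assumes "finite Y" "finite F" "finite C" "F \<inter> Y = {}" "0 \<le> p" "p \<le> 1"
    and "\<And>x y. x \<in> F \<Longrightarrow> y \<in> Y \<Longrightarrow> {x, y} \<in> C"
  shows "measure_pmf.expectation (Pi_pmf C False (\<lambda>_. bernoulli_pmf p))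
      (\<lambda>f. exp (c * card (neighbours_in f F Y))) = (1 + (1 - (1 - p) ^ card F) * (exp c - 1)) ^ card Y"
  using assms
proof (induction Y arbitrary: C rule: finite_induct)
  case empty
  then show ?case by (simp add: neighbours_in_def)
next
  case (insert y Y)
  let ?P = "\<lambda>_ :: 'a set. bernoulli_pmf p"
  let ?q = "1 + (1 - (1 - p) ^ card F) * (exp c - 1)"
  define K where "K = (\<lambda>x. {x, y}) ` F"
  have K: "K \<subseteq> C" using insert.prems by (auto simp: K_def)
  have cK: "card K = card F"
    unfolding K_def by (intro card_image inj_onI) (auto simp: doubleton_eq_iff)
  have fK: "finite K" using insert.prems by (simp add: K_def)
  have notK: "{x, z} \<notin> K" if "x \<in> F" "z \<in> Y" for x z
    using that insert.prems insert.hyps by (auto simp: K_def doubleton_eq_iff)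
  have split: "exp (c * card (neighbours_in (\<lambda>e. if e \<in> K then f e else g e) F (insert y Y)))
      = exp (c * of_bool (\<exists>e\<in>K. f e)) * exp (c * card (neighbours_in g F Y))" for f g
  proof -
    let ?h = "\<lambda>e. if e \<in> K then f e else g e"
    have "neighbours_in ?h F (insert y Y) = neighbours_in g F Y \<union> (if \<exists>e\<in>K. f e then {y} else {})"
      using notK by (auto simp: neighbours_in_def K_def)
    moreover have "finite (neighbours_in g F Y)" "y \<notin> neighbours_in g F Y"
      using insert.hyps by (auto simp: neighbours_in_def)
    ultimately show ?thesis by (auto simp: exp_add[symmetric] algebra_simps)
  qed
  have first: "measure_pmf.expectation (Pi_pmf K False ?P) (\<lambda>f. exp (c * of_bool (\<exists>e\<in>K. f e))) = ?q"
  proof -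
    have "(\<lambda>f. exp (c * of_bool (\<exists>e\<in>K. f e)))
        = (\<lambda>f. exp c - (exp c - 1) * indicator {f. \<forall>e\<in>K. \<not> f e} f)"
      by (auto simp: fun_eq_iff indicator_def)
    then have "measure_pmf.expectation (Pi_pmf K False ?P) (\<lambda>f. exp (c * of_bool (\<exists>e\<in>K. f e)))
        = exp c - (exp c - 1) * measure_pmf.prob (Pi_pmf K False ?P) {f. \<forall>e\<in>K. \<not> f e}"
      using fK by (simp add: measure_pmf.prob_space)
    then show ?thesis
      using prob_Pi_pmf_bernoulli_none[OF fK order_refl, of p] insert.prems cK by (simp add: algebra_simps)
  qed
  have "measure_pmf.expectation (Pi_pmf C False ?P) (\<lambda>f. exp (c * card (neighbours_in f F (insert y Y))))
    = measure_pmf.expectation (Pi_pmf K False ?P) (\<lambda>f. exp (c * of_bool (\<exists>e\<in>K. f e))) *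
      measure_pmf.expectation (Pi_pmf (C - K) False ?P) (\<lambda>g. exp (c * card (neighbours_in g F Y)))"
    using insert.prems K by (subst expectation_Pi_pmf_split[of C K]) (simp_all add: split)
  also have "measure_pmf.expectation (Pi_pmf (C - K) False ?P)
      (\<lambda>g. exp (c * card (neighbours_in g F Y))) = ?q ^ card Y"
    using insert.prems notK by (intro insert.IH) auto
  finally show ?case using first insert.hyps by simp
qed

text \<open>The ball of radius \<open>j\<close> around \<open>F\<close> in the graph induced on \<open>W\<close>. Exposing the neighbours of \<open>F\<close>
  outside \<open>F\<close> leaves the edges inside \<open>W - F\<close>, on which the recursive call depends, unexposed.\<close>

primrec explore :: "('a set \<Rightarrow> bool) \<Rightarrow> nat \<Rightarrow> 'a set \<Rightarrow> 'a set \<Rightarrow> 'a set" where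
  "explore f 0 W F = F"
| "explore f (Suc j) W F = F \<union> explore f j (W - F) (neighbours_in f F (W - F))"

lemma explore_subset: "F \<subseteq> W \<Longrightarrow> explore f j W F \<subseteq> W"
proof (induction j arbitrary: W F)
  case (Suc j)
  have "explore f j (W - F) (neighbours_in f F (W - F)) \<subseteq> W - F"
    by (rule Suc.IH) (auto simp: neighbours_in_def)
  with Suc.prems show ?case by auto
qed simp

lemma explore_superset: "F \<subseteq> explore f j W F"
  by (cases j) auto

text \<open>Peeling off the first layer suits the exposure of edges; adding a last layer suits
  monotonicity and walks. Both agree because edges into \<open>F\<close> or out of \<open>F\<close>
  lead only to vertices already present.\<close>

lemma explore_Suc_eq:
  assumes "F \<subseteq> W"
  shows "explore f (Suc j) W F = explore f j W F \<union> neighbours_in f (explore f j W F) W"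
  using assms
proof (induction j arbitrary: W F)
  case 0
  then show ?case by (auto simp: neighbours_in_def)
next
  case (Suc j)
  let ?N = "neighbours_in f F (W - F)"
  let ?B = "explore f j (W - F) ?N"
  have N: "?N \<subseteq> W - F" by (auto simp: neighbours_in_def)
  have "explore f (Suc (Suc j)) W F = F \<union> (?B \<union> neighbours_in f ?B (W - F))"
    using Suc.IH[OF N] by simp
  also have "\<dots> = (F \<union> ?B) \<union> neighbours_in f (F \<union> ?B) W"
    using explore_superset[of ?N f j "W - F"] by (auto simp: neighbours_in_def)
  finally show ?case by simp
qed

lemma explore_mono:
  assumes "F \<subseteq> F'" "F' \<subseteq> W" shows "explore f j W F \<subseteq> explore f j W F'"
proof (induction j)
  case (Suc j)
  then have "neighbours_in f (explore f j W F) W \<subseteq> neighbours_in f (explore f j W F') W"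
    by (auto simp: neighbours_in_def)
  with Suc assms show ?case by (simp del: explore.simps add: explore_Suc_eq) blast
qed (use assms in simp)

lemma explore_cong:
  assumes "F \<subseteq> W" "\<And>e. e \<in> all_edges W \<Longrightarrow> f e = g e"
  shows "explore f j W F = explore g j W F"
  using assms
proof (induction j arbitrary: W F)
  case (Suc j)
  have "f {x, y} = g {x, y}" if "x \<in> F" "y \<in> W - F" for x y
    using that Suc.prems by (intro Suc.prems) (auto simp: all_edges_def card_2_iff)
  then have "neighbours_in f F (W - F) = neighbours_in g F (W - F)"
    by (auto simp: neighbours_in_def)
  moreover have "explore f j (W - F) (neighbours_in g F (W - F))
      = explore g j (W - F) (neighbours_in g F (W - F))"
    using Suc.prems by (intro Suc.IH) (auto simp: neighbours_in_def all_edges_def)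
  ultimately show ?case by simp
qed simp

lemma finite_all_edges: "finite V \<Longrightarrow> finite (all_edges V)"
  unfolding all_edges_def by (rule finite_subset[of _ "Pow V"]) auto

lemma neighbours_in_edges:
  assumes "F \<subseteq> W" "all_edges W \<subseteq> C" "x \<in> F" "y \<in> W - F"
  shows "{x, y} \<in> C - all_edges (W - F)"
proof -
  have "{x, y} \<in> all_edges W" using assms by (auto simp: all_edges_def card_2_iff)
  moreover have "{x, y} \<notin> all_edges (W - F)" using assms by (auto simp: all_edges_def)
  ultimately show ?thesis using assms by auto
qed

text \<open>Edges inside \<open>W - F\<close> govern everything after the next layer, and the
  remaining ones govern that layer. The inner expectation thus concerns a fresh random graph on
  \<open>W - F\<close> with a fixed starting set.\<close>

lemma expectation_explore_Suc:
  fixes P :: "'a set \<Rightarrow> bool pmf" and \<phi> :: "'a set \<Rightarrow> real"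
  assumes C: "finite C" "all_edges W \<subseteq> C" and F: "F \<subseteq> W"
  shows "measure_pmf.expectation (Pi_pmf C False P) (\<lambda>f. \<phi> (explore f (Suc j) W F)) =
    measure_pmf.expectation (Pi_pmf (C - all_edges (W - F)) False P) (\<lambda>f.
      measure_pmf.expectation (Pi_pmf (all_edges (W - F)) False P) (\<lambda>g.
        \<phi> (F \<union> explore g j (W - F) (neighbours_in f F (W - F)))))"
proof -
  let ?R = "all_edges (W - F)"
  have R: "C - (C - ?R) = ?R" using C by (auto simp: all_edges_def)
  have eq: "explore (\<lambda>e. if e \<in> C - ?R then f e else g e) (Suc j) W F
      = F \<union> explore g j (W - F) (neighbours_in f F (W - F))" for f g
  proof -
    let ?h = "\<lambda>e. if e \<in> C - ?R then f e else g e"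
    have "?h {x, y} = f {x, y}" if "x \<in> F" "y \<in> W - F" for x y
      using neighbours_in_edges[OF F C(2) that] by auto
    then have "neighbours_in ?h F (W - F) = neighbours_in f F (W - F)"
      by (rule neighbours_in_cong)
    moreover have "explore ?h j (W - F) (neighbours_in f F (W - F))
        = explore g j (W - F) (neighbours_in f F (W - F))"
      by (intro explore_cong) (auto simp: neighbours_in_def)
    ultimately show ?thesis by simp
  qed
  show ?thesis
    using C by (subst expectation_Pi_pmf_split[of C "C - ?R"]) (simp_all only: eq R Diff_subset)
qed

section \<open>Upper tail: positive exponential moments\<close>

text \<open>Exposing a layer turns the rate \<open>a\<close> into
  \<open>l + d * (exp a - 1)\<close>. With \<open>l \<le> exp a - 1\<close> and
  \<open>exp a - 1 \<le> a / (1 - a)\<close> this is at most \<open>D * a / (1 - a)\<close>, whose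
  reciprocal \<open>(1 / a - 1) / D\<close> is affine in \<open>1 / a\<close> with fixed point
  \<open>- 1 / d\<close>. So \<open>1 / a + 1 / d\<close> is divided by \<open>D\<close> at each
  layer, which explains the shifts by \<open>1 / d\<close>.\<close>

lemma upper_rate_step:
  fixes a d l x D :: real
  assumes "0 < d" "D = d + 1" "1 / d < x" "0 < l" "l \<le> a" "a = 1 / (D * x - 1 / d)"
  shows "l + d * (exp a - 1) \<le> 1 / (x - 1 / d)"
proof -
  have Dx: "1 < D * x - 1 / d"
  proof -
    have "D * (1 / d) < D * x" using assms by (intro mult_strict_left_mono) auto
    moreover have "D * (1 / d) - 1 / d = 1" using assms by (simp add: field_simps)
    ultimately show ?thesis by linarith
  qed
  have a: "0 < a" "a < 1" using Dx assms by auto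
  have "exp a \<le> 1 / (1 - a)"
  proof -
    have "1 - a \<le> exp (- a)" using exp_ge_add_one_self[of "-a"] by simp
    then show ?thesis using a by (simp add: exp_minus field_simps)
  qed
  then have e: "exp a - 1 \<le> a / (1 - a)" using a by (simp add: field_simps)
  have "l \<le> exp a - 1" using exp_ge_add_one_self[of a] assms by linarith
  then have "l + d * (exp a - 1) \<le> D * (exp a - 1)" using assms by (simp add: algebra_simps)
  also have "\<dots> \<le> D * (a / (1 - a))" using e assms by (intro mult_left_mono) auto
  also have "a / (1 - a) = 1 / (D * x - 1 / d - 1)"
  proof -
    have "a / (1 - a) = 1 / (1 / a - 1)" using a by (simp add: field_simps)
    then show ?thesis using assms by simp
  qed
  also have "D * (1 / (D * x - 1 / d - 1)) = 1 / (x - 1 / d)"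
  proof -
    have "D * x - 1 / d - 1 = D * (x - 1 / d)" using assms by (simp add: field_simps)
    then show ?thesis using assms by simp
  qed
  finally show ?thesis .
qed

text \<open>A vertex joins the first layer with probability at most \<open>p * card F\<close>, so
  the exponent stays linear in \<open>card F\<close> and the induction only has to follow the rate.
  The condition on \<open>1 / d\<close> keeps all rates positive and finite.\<close>

lemma expectation_exp_card_explore_le:
  fixes p d D l :: real
  assumes p: "0 \<le> p" "p \<le> 1" and d: "0 < d" "D = d + 1" and l: "0 < l"
    and "1 / d < 1 / (l * D ^ j)" "finite W" "p * card W \<le> d" "F \<subseteq> W" "finite C" "all_edges W \<subseteq> C"
  shows "measure_pmf.expectation (Pi_pmf C False (\<lambda>_. bernoulli_pmf p))
      (\<lambda>f. exp (l * card (explore f j W F))) \<le> exp (card F * (1 / (1 / (l * D ^ j) - 1 / d)))"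
  using assms(6-)
proof (induction j arbitrary: W F C)
  case 0
  have "l \<le> 1 / (1 / l - 1 / d)"
    using 0(1) d l by (simp add: field_simps)
  then have "card F * l \<le> card F * (1 / (1 / l - 1 / d))" by (intro mult_left_mono) auto
  then show ?case by (simp add: mult.commute measure_pmf.prob_space)
next
  case (Suc j)
  let ?P = "\<lambda>_ :: 'a set. bernoulli_pmf p"
  let ?Y = "W - F"
  let ?R = "all_edges (W - F)"
  define a where "a = 1 / (1 / (l * D ^ j) - 1 / d)"
  define x where "x = 1 / (l * D ^ Suc j)"
  have D: "1 < D" using d by simp
  have Dx: "1 / (l * D ^ j) = D * x" using D by (simp add: x_def)
  have x: "1 / d < x" using Suc.prems by (simp add: x_def)
  have x0: "0 < x" using x d by (meson divide_pos_pos less_trans zero_less_one)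
  have j: "1 / d < 1 / (l * D ^ j)" unfolding Dx using x x0 D by (smt (verit) mult_less_cancel_right1)
  have la: "l \<le> a"
  proof -
    have "1 / (l * D ^ j) \<le> 1 / l" using D l by (intro divide_left_mono) auto
    then have "1 / (l * D ^ j) - 1 / d \<le> 1 / l" using d by (smt (verit) divide_pos_pos)
    then have "1 / (1 / l) \<le> a" unfolding a_def using j l by (intro divide_left_mono) auto
    then show ?thesis by simp
  qed
  have fin: "finite F" "finite ?Y" using Suc.prems finite_subset by auto
  have inner: "measure_pmf.expectation (Pi_pmf ?R False ?P)
      (\<lambda>g. exp (l * card (F \<union> explore g j ?Y (neighbours_in f F ?Y))))
      \<le> exp (l * card F) * exp (a * card (neighbours_in f F ?Y))" for f
  proof -
    have N: "neighbours_in f F ?Y \<subseteq> ?Y" by (auto simp: neighbours_in_def)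
    have "exp (l * card (F \<union> explore g j ?Y (neighbours_in f F ?Y)))
        = exp (l * card F) * exp (l * card (explore g j ?Y (neighbours_in f F ?Y)))" for g
    proof -
      have "explore g j ?Y (neighbours_in f F ?Y) \<subseteq> ?Y" by (rule explore_subset[OF N])
      then have "card (F \<union> explore g j ?Y (neighbours_in f F ?Y))
          = card F + card (explore g j ?Y (neighbours_in f F ?Y))"
        using fin by (intro card_Un_disjoint) (auto intro: finite_subset)
      then show ?thesis by (simp add: exp_add[symmetric] algebra_simps)
    qed
    moreover have "measure_pmf.expectation (Pi_pmf ?R False ?P)
        (\<lambda>g. exp (l * card (explore g j ?Y (neighbours_in f F ?Y))))
        \<le> exp (card (neighbours_in f F ?Y) * a)"
      unfolding a_def
    proof (rule Suc.IH[OF j fin(2) _ N])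
      have "p * card ?Y \<le> p * card W" using p Suc.prems by (intro mult_left_mono) (auto intro: card_mono)
      then show "p * card ?Y \<le> d" using Suc.prems by linarith
    qed (use finite_all_edges fin in auto)
    ultimately show ?thesis by (simp add: mult.commute)
  qed
  have "measure_pmf.expectation (Pi_pmf C False ?P) (\<lambda>f. exp (l * card (explore f (Suc j) W F)))
     = measure_pmf.expectation (Pi_pmf (C - ?R) False ?P) (\<lambda>f.
      measure_pmf.expectation (Pi_pmf ?R False ?P)
        (\<lambda>g. exp (l * card (F \<union> explore g j ?Y (neighbours_in f F ?Y)))))"
    using Suc.prems by (intro expectation_explore_Suc) auto
  also have "\<dots> \<le> measure_pmf.expectation (Pi_pmf (C - ?R) False ?P)
      (\<lambda>f. exp (l * card F) * exp (a * card (neighbours_in f F ?Y)))"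
    using Suc.prems inner by (intro integral_mono) auto
  also have "\<dots> = exp (l * card F) * (1 + (1 - (1 - p) ^ card F) * (exp a - 1)) ^ card ?Y"
  proof -
    have "measure_pmf.expectation (Pi_pmf (C - ?R) False ?P) (\<lambda>f. exp (a * card (neighbours_in f F ?Y)))
        = (1 + (1 - (1 - p) ^ card F) * (exp a - 1)) ^ card ?Y"
      using Suc.prems p fin neighbours_in_edges[of F W C]
      by (intro expectation_exp_card_neighbours_in) auto
    then show ?thesis by simp
  qed
  also have "\<dots> \<le> exp (l * card F) * exp (p * card F * (exp a - 1)) ^ card ?Y"
  proof (intro mult_left_mono power_mono)
    have "1 - p * card F \<le> (1 - p) ^ card F"
      using Bernoulli_inequality[of "-p" "card F"] p by (simp add: mult.commute)
    moreover have "1 \<le> exp a" using la l by simp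
    ultimately have "1 + (1 - (1 - p) ^ card F) * (exp a - 1) \<le> 1 + p * card F * (exp a - 1)"
      by (intro add_left_mono mult_right_mono) auto
    also have "\<dots> \<le> exp (p * card F * (exp a - 1))" by (rule exp_ge_add_one_self)
    finally show "1 + (1 - (1 - p) ^ card F) * (exp a - 1) \<le> exp (p * card F * (exp a - 1))" .
    have "(1 - p) ^ card F \<le> 1" using p by (intro power_le_one) auto
    then show "0 \<le> 1 + (1 - (1 - p) ^ card F) * (exp a - 1)"
      using \<open>1 \<le> exp a\<close> by simp
  qed auto
  also have "\<dots> = exp (card F * (l + p * card ?Y * (exp a - 1)))"
    by (simp add: exp_of_nat_mult[symmetric] exp_add[symmetric] algebra_simps)
  also have "\<dots> \<le> exp (card F * (l + d * (exp a - 1)))"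
  proof -
    have "p * card ?Y \<le> p * card W" using p Suc.prems by (intro mult_left_mono) (auto intro: card_mono)
    then have "p * card ?Y \<le> d" using Suc.prems by linarith
    moreover have "1 \<le> exp a" using la l by simp
    ultimately have "p * card ?Y * (exp a - 1) \<le> d * (exp a - 1)" by (intro mult_right_mono) auto
    then show ?thesis by (simp add: mult_left_mono)
  qed
  also have "\<dots> \<le> exp (card F * (1 / (x - 1 / d)))"
  proof -
    have "l + d * (exp a - 1) \<le> 1 / (x - 1 / d)"
      using d x l la a_def unfolding Dx by (rule upper_rate_step)
    then show ?thesis by (simp only: exp_le_cancel_iff) (intro mult_left_mono, auto)
  qed
  finally show ?case by (simp only: x_def)
qed

section \<open>Lower tail: negative exponential moments\<close>

lemma one_minus_exp_neg_lower:
  fixes a :: real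
  assumes "0 \<le> a" shows "a * (1 - a) \<le> 1 - exp (- a)"
proof -
  have "1 + a \<le> exp a" by (rule exp_ge_add_one_self)
  then have "exp (- a) \<le> 1 / (1 + a)" using assms by (simp add: exp_minus field_simps)
  moreover have "a * (1 - a) \<le> 1 - 1 / (1 + a)"
    using assms by (simp add: field_simps power2_eq_square)
  ultimately show ?thesis by linarith
qed

lemma one_minus_power_upper:
  fixes p :: real
  assumes "0 \<le> p" "p \<le> 1"
  shows "p * k * (1 - p * k) \<le> 1 - (1 - p) ^ k"
proof -
  have "(1 - p) ^ k \<le> exp (- p) ^ k"
    using assms exp_ge_add_one_self[of "-p"] by (intro power_mono) auto
  also have "\<dots> = exp (- (p * k))" by (simp add: exp_of_nat_mult[symmetric] mult.commute)
  also have "\<dots> \<le> 1 - p * k * (1 - p * k)"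
    using one_minus_exp_neg_lower[of "p * k"] assms by simp
  finally show ?thesis by linarith
qed

text \<open>Every layer loses something: the factors with \<open>10 * d ^ k / card V\<close> account
  for vertices used up or hit repeatedly, those with \<open>K / d ^ k\<close> for the second-order
  term of \<open>1 - exp (- a)\<close>. \<open>\<pi> r\<close> collects the losses after layer
  \<open>r\<close>. The additive term pays for trimming, without which an unusually large layer
  would spoil the first-order estimates.\<close>

lemma expectation_exp_neg_card_explore_le:
  fixes p d K :: real and i :: nat and V :: "'a set"
  defines "\<pi> \<equiv> \<lambda>r. \<Prod>k\<in>{r<..i}. (1 - 10 * d ^ k / card V) * (1 - K / d ^ k)"
  assumes p: "0 \<le> p" "p \<le> 1" and V: "finite V" "d = p * card V" and d: "2 \<le> d" and K: "0 < K"
    and small: "\<And>k. 1 \<le> k \<Longrightarrow> k \<le> i \<Longrightarrow> 10 * d ^ k / card V \<le> 1 \<and> K / d ^ k \<le> 1"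
    and \<pi>0: "3/4 \<le> \<pi> 0"
    and "r + j = i" "W \<subseteq> V" "card V - 5 * d ^ r \<le> card W" "F \<subseteq> W" "card F \<le> 5 * d ^ r"
      "finite C" "all_edges W \<subseteq> C"
  shows "measure_pmf.expectation (Pi_pmf C False (\<lambda>_. bernoulli_pmf p))
      (\<lambda>f. exp (- (K / d ^ i * card (explore f j W F)))) \<le>
    exp (- (K / d ^ r * \<pi> r * card F)) + j * exp (- 3 * K)"
  using assms(10-)
proof (induction j arbitrary: r W F C)
  case 0
  then have "\<pi> r = 1" by (simp add: \<pi>_def)
  then show ?case using 0 by (simp add: measure_pmf.prob_space)
next
  case (Suc j)
  let ?P = "\<lambda>_ :: 'a set. bernoulli_pmf p"
  let ?Y = "W - F"
  let ?R = "all_edges (W - F)"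
  let ?r = "Suc r"
  define n where "n = real (card V)"
  define x where "x = 10 * d ^ ?r / n"
  define y where "y = K / d ^ ?r"
  define l where "l = K / d ^ i"
  define a where "a = K / d ^ ?r * \<pi> ?r"
  have n0: "0 < n" using V(2) d by (cases "card V = 0") (auto simp: n_def)
  have xy: "0 \<le> x" "x \<le> 1" "0 \<le> y" "y \<le> 1"
    using small[of ?r] Suc.prems d K by (auto simp: x_def y_def n_def)
  have "finite W" using Suc.prems V(1) by (rule_tac finite_subset[of W V])
  then have fin: "finite W" "finite F" "finite ?Y"
    using Suc.prems(4) by (auto intro: finite_subset)
  have finR: "finite ?R" using fin by (intro finite_all_edges)
  have factor: "0 \<le> (1 - 10 * d ^ k / card V) * (1 - K / d ^ k) \<and>
      (1 - 10 * d ^ k / card V) * (1 - K / d ^ k) \<le> 1" if "k \<in> {0<..i}" for k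
    using small[of k] that d K by (auto intro!: mult_le_one)
  have \<pi>_Suc: "\<pi> r = (1 - x) * (1 - y) * \<pi> ?r"
  proof -
    have "{r<..i} = insert ?r {?r<..i}" using Suc.prems by auto
    then show ?thesis by (simp add: \<pi>_def x_def y_def n_def)
  qed
  have \<pi>1: "\<pi> ?r \<le> 1" unfolding \<pi>_def using factor by (intro prod_le_1) auto
  have \<pi>34: "3/4 \<le> \<pi> ?r"
  proof -
    have "{0<..i} = {0<..?r} \<union> {?r<..i}" using Suc.prems by auto
    then have "\<pi> 0 = (\<Prod>k\<in>{0<..?r}. (1 - 10 * d ^ k / card V) * (1 - K / d ^ k)) * \<pi> ?r"
      unfolding \<pi>_def by (simp only:) (subst prod.union_disjoint, auto)
    also have "\<dots> \<le> 1 * \<pi> ?r"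
      using factor Suc.prems unfolding \<pi>_def
      by (intro mult_right_mono prod_le_1 prod_nonneg) auto
    finally show ?thesis using \<pi>0 by simp
  qed
  have a: "0 \<le> a" "a \<le> y"
    using \<pi>1 \<pi>34 xy unfolding a_def y_def[symmetric] by (auto simp: mult_left_le)
  have size_Y: "n - 10 * d ^ r \<le> card ?Y"
  proof -
    have "real (card ?Y) = real (card W) - real (card F)"
      using Suc.prems fin by (simp add: card_Diff_subset card_mono of_nat_diff)
    then show ?thesis using Suc.prems by (simp add: n_def)
  qed
  have inner: "measure_pmf.expectation (Pi_pmf ?R False ?P)
      (\<lambda>g. exp (- (l * card (F \<union> explore g j ?Y (neighbours_in f F ?Y)))))
      \<le> exp (- (a * card (neighbours_in f F ?Y))) + Suc j * exp (- 3 * K)" for f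
  proof -
    let ?N = "neighbours_in f F ?Y"
    \<comment> \<open>As \<open>\<pi>\<close> is at least 3/4, keeping \<open>4 * d ^ ?r\<close>
      vertices gives an exponent of at least \<open>3 * K\<close>, more than the roughly
      \<open>2 * K\<close> needed for a start at two vertices. Rounding up stays within the allowed
      \<open>5 * d ^ ?r\<close>.\<close>
    define m where "m = nat \<lceil>4 * d ^ ?r\<rceil>"
    have dr: "1 \<le> d ^ ?r" using d by (intro one_le_power) auto
    have m: "4 * d ^ ?r \<le> real m" "real m \<le> 5 * d ^ ?r" using dr unfolding m_def by linarith+
    have N: "?N \<subseteq> ?Y" by (auto simp: neighbours_in_def)
    \<comment> \<open>Trimming the layer to \<open>m\<close> vertices keeps the explored part small; it costs at most \<open>exp (- 3 * K)\<close>.\<close>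
    obtain N' where N': "N' \<subseteq> ?N" "card N' = min (card ?N) m"
      by (meson min.cobounded1 obtain_subset_with_card_n)
    \<comment> \<open>\<open>F\<close> is dropped from the count: only the last layer, of order
      \<open>d ^ i\<close>, has to be large.\<close>
    have "measure_pmf.expectation (Pi_pmf ?R False ?P)
      (\<lambda>g. exp (- (l * card (F \<union> explore g j ?Y ?N))))
      \<le> measure_pmf.expectation (Pi_pmf ?R False ?P) (\<lambda>g. exp (- (l * card (explore g j ?Y N'))))"
    proof (intro integral_mono)
      fix g
      have "explore g j ?Y ?N \<subseteq> ?Y" by (rule explore_subset[OF N])
      moreover have "explore g j ?Y N' \<subseteq> explore g j ?Y ?N" using N' N by (intro explore_mono)
      ultimately have "card (explore g j ?Y N') \<le> card (F \<union> explore g j ?Y ?N)"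
        using fin by (intro card_mono) (auto intro: finite_subset)
      moreover have "0 \<le> l" using K d by (simp add: l_def)
      ultimately show "exp (- (l * card (F \<union> explore g j ?Y ?N))) \<le> exp (- (l * card (explore g j ?Y N')))"
        by (simp add: mult_left_mono)
    qed (simp_all only: integrable_Pi_pmf_bool finR)
    also have "\<dots> \<le> exp (- (a * card N')) + j * exp (- 3 * K)"
      unfolding l_def a_def
    proof (rule Suc.IH)
      have "2 * d ^ r \<le> d ^ ?r" using d by (simp add: mult_right_mono)
      then show "card V - 5 * d ^ ?r \<le> card ?Y" using size_Y unfolding n_def by linarith
      have "card N' \<le> m" using N' by simp
      then show "card N' \<le> 5 * d ^ ?r" using m by linarith
      show "?r + j = i" "?Y \<subseteq> V" using Suc.prems(1,2) by auto
      show "N' \<subseteq> ?Y" using N N' by blast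
    qed (rule finR order_refl)+
    also have "\<dots> \<le> exp (- (a * card ?N)) + Suc j * exp (- 3 * K)"
    proof (cases "card ?N \<le> m")
      case False
      have "3 * K \<le> 4 * K * \<pi> ?r" using \<pi>34 K by (simp add: mult_left_mono)
      also have "\<dots> = a * (4 * d ^ ?r)" using d by (simp add: a_def)
      also have "\<dots> \<le> a * card N'" using N' False m a by (intro mult_left_mono) auto
      finally have "exp (- (a * card N')) \<le> exp (- 3 * K)" by simp
      moreover have "Suc j * exp (- 3 * K) = j * exp (- 3 * K) + exp (- 3 * K)"
        by (simp add: algebra_simps)
      ultimately show ?thesis using exp_ge_zero[of "- (a * card ?N)"] by linarith
    qed (use N' in \<open>simp add: algebra_simps\<close>)
    finally show ?thesis .
  qed
  have "measure_pmf.expectation (Pi_pmf C False ?P) (\<lambda>f. exp (- (l * card (explore f (Suc j) W F))))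
     = measure_pmf.expectation (Pi_pmf (C - ?R) False ?P) (\<lambda>f.
      measure_pmf.expectation (Pi_pmf ?R False ?P)
        (\<lambda>g. exp (- (l * card (F \<union> explore g j ?Y (neighbours_in f F ?Y))))))"
    using Suc.prems by (intro expectation_explore_Suc) auto
  also have "\<dots> \<le> measure_pmf.expectation (Pi_pmf (C - ?R) False ?P)
      (\<lambda>f. exp (- (a * card (neighbours_in f F ?Y))) + Suc j * exp (- 3 * K))"
    using Suc.prems inner by (intro integral_mono) auto
  also have "\<dots> = measure_pmf.expectation (Pi_pmf (C - ?R) False ?P)
      (\<lambda>f. exp (- a * card (neighbours_in f F ?Y))) + Suc j * exp (- 3 * K)"
    using Suc.prems by (simp add: measure_pmf.prob_space)
  finally have "measure_pmf.expectation (Pi_pmf C False ?P)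
        (\<lambda>f. exp (- (l * card (explore f (Suc j) W F))))
      \<le> measure_pmf.expectation (Pi_pmf (C - ?R) False ?P)
        (\<lambda>f. exp (- a * card (neighbours_in f F ?Y))) + Suc j * exp (- 3 * K)" .
  moreover have "measure_pmf.expectation (Pi_pmf (C - ?R) False ?P)
      (\<lambda>f. exp (- a * card (neighbours_in f F ?Y))) \<le> exp (- (K / d ^ r * \<pi> r * card F))"
  proof -
    have "measure_pmf.expectation (Pi_pmf (C - ?R) False ?P)
        (\<lambda>f. exp (- a * card (neighbours_in f F ?Y)))
        = (1 + (1 - (1 - p) ^ card F) * (exp (- a) - 1)) ^ card ?Y"
      using Suc.prems p fin neighbours_in_edges[of F W C]
      by (intro expectation_exp_card_neighbours_in) auto
    also have "\<dots> \<le> exp (- ((1 - (1 - p) ^ card F) * (1 - exp (- a)))) ^ card ?Y"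
    proof (rule power_mono)
      show "1 + (1 - (1 - p) ^ card F) * (exp (- a) - 1) \<le> exp (- ((1 - (1 - p) ^ card F) * (1 - exp (- a))))"
        using exp_ge_add_one_self[of "- ((1 - (1 - p) ^ card F) * (1 - exp (- a)))"]
        by (simp add: algebra_simps)
      have "0 \<le> (1 - p) ^ card F" "(1 - p) ^ card F \<le> 1" using p by (auto intro: power_le_one)
      then have "(1 - (1 - p) ^ card F) * (1 - exp (- a)) \<le> 1" using a by (intro mult_le_one) auto
      then show "0 \<le> 1 + (1 - (1 - p) ^ card F) * (exp (- a) - 1)" by (simp add: algebra_simps)
    qed
    also have "\<dots> = exp (- (card ?Y * (1 - (1 - p) ^ card F) * (1 - exp (- a))))"
      by (simp add: exp_of_nat_mult[symmetric])
    also have "\<dots> \<le> exp (- (K / d ^ r * \<pi> r * card F))"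
    proof -
      define c where "c = real (card F)"
      have pc: "p * c \<le> x / 2"
      proof -
        have "p * c \<le> p * (5 * d ^ r)" using Suc.prems p by (intro mult_left_mono) (auto simp: c_def)
        also have "p * (5 * d ^ r) = d / n * (5 * d ^ r)" using n0 V(2) by (simp add: n_def)
        also have "\<dots> = x / 2" by (simp add: x_def)
        finally show ?thesis .
      qed
      have Y: "n * (1 - x / 2) \<le> card ?Y"
      proof -
        have "2 * d ^ r \<le> d * d ^ r" using d by (intro mult_right_mono) auto
        moreover have "n * (1 - x / 2) = n - 5 * (d * d ^ r)" using n0 by (simp add: x_def field_simps)
        ultimately show ?thesis using size_Y by linarith
      qed
      \<comment> \<open>Half of the loss \<open>x\<close> comes from vertices missing in
        \<open>?Y\<close>, the other half from multiple hits.\<close>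
      have "d * c * (1 - x) \<le> d * c * ((1 - x / 2) * (1 - x / 2))"
        using d xy by (intro mult_left_mono) (auto simp: c_def algebra_simps)
      also have "\<dots> = (n * (1 - x / 2)) * (p * c * (1 - x / 2))"
        unfolding V(2) n_def[symmetric] by (simp only: mult_ac)
      also have "\<dots> \<le> card ?Y * (1 - (1 - p) ^ card F)"
      proof (rule mult_mono[OF Y])
        have "p * c * (1 - x / 2) \<le> p * c * (1 - p * c)"
          using pc p by (intro mult_left_mono) (auto simp: c_def)
        also have "\<dots> \<le> 1 - (1 - p) ^ card F"
          unfolding c_def using p by (rule one_minus_power_upper)
        finally show "p * c * (1 - x / 2) \<le> 1 - (1 - p) ^ card F" .
      qed (use p xy in \<open>auto simp: c_def\<close>)
      finally have 1: "d * c * (1 - x) \<le> card ?Y * (1 - (1 - p) ^ card F)" .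
      have 2: "a * (1 - y) \<le> 1 - exp (- a)"
      proof -
        have "a * (1 - y) \<le> a * (1 - a)" using a by (intro mult_left_mono) auto
        then show ?thesis using one_minus_exp_neg_lower[OF a(1)] by linarith
      qed
      have "(d * c * (1 - x)) * (a * (1 - y)) \<le> (card ?Y * (1 - (1 - p) ^ card F)) * (1 - exp (- a))"
        by (rule mult_mono[OF 1 2]) (use a xy p in \<open>auto simp: power_le_one\<close>)
      moreover have "K / d ^ r * \<pi> r * c = (d * c * (1 - x)) * (a * (1 - y))"
        using d by (simp add: \<pi>_Suc a_def)
      ultimately show ?thesis by (simp add: c_def)
    qed
    finally show ?thesis .
  qed
  ultimately show ?case unfolding l_def by linarith
qed

subsection \<open>Concentration of ball sizes\<close>

lemma prob_ge_le_exp: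
  fixes X :: "'a \<Rightarrow> real"
  assumes "integrable (measure_pmf M) (\<lambda>x. exp (X x))"
  shows "measure_pmf.prob M {x. t \<le> X x} \<le> exp (- t) * measure_pmf.expectation M (\<lambda>x. exp (X x))"
proof -
  have "measure_pmf.prob M {x. t \<le> X x} = measure_pmf.expectation M (indicator {x. t \<le> X x})"
    by simp
  also have "\<dots> \<le> measure_pmf.expectation M (\<lambda>x. exp (- t) * exp (X x))"
    using assms
    by (intro integral_mono integrable_mult_right)
      (auto simp: exp_add[symmetric] indicator_def measure_pmf.integrable_const_bound[where B = 1])
  finally show ?thesis by simp
qed

lemma sum_powers_le:
  fixes d :: real
  assumes "2 \<le> d" shows "(\<Sum>k\<in>{0<..i}. d ^ k) \<le> 2 * d ^ i"
proof (induction i)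
  case (Suc i)
  have "{0<..Suc i} = insert (Suc i) {0<..i}" by auto
  moreover have "2 * d ^ i \<le> d * d ^ i" using assms by (intro mult_right_mono) auto
  ultimately show ?case using Suc by simp
qed simp

lemma sum_inverse_powers_le:
  fixes d :: real
  assumes "2 \<le> d" shows "(\<Sum>k\<in>{0<..i}. 1 / d ^ k) \<le> 2 / d"
proof -
  \<comment> \<open>The extra summand strengthens the claim so that the induction closes.\<close>
  have "(\<Sum>k\<in>{0<..i}. 1 / d ^ k) + 2 / d * (1 / d ^ i) \<le> 2 / d"
  proof (induction i)
    case (Suc i)
    have "{0<..Suc i} = insert (Suc i) {0<..i}" by auto
    then have "(\<Sum>k\<in>{0<..Suc i}. 1 / d ^ k) = (\<Sum>k\<in>{0<..i}. 1 / d ^ k) + 1 / d ^ Suc i"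
      by simp
    moreover have "1 / d ^ Suc i + 2 / d * (1 / d ^ Suc i) \<le> 2 / d * (1 / d ^ i)"
    proof -
      have "(1 + 2 / d) * (1 / d ^ Suc i) \<le> 2 * (1 / d ^ Suc i)"
        using assms by (intro mult_right_mono) (auto simp: field_simps)
      then show ?thesis using assms by (simp add: field_simps)
    qed
    ultimately show ?case using Suc by linarith
  qed simp
  moreover have "0 \<le> 2 / d * (1 / d ^ i)" using assms by simp
  ultimately show ?thesis by linarith
qed

lemma prob_explore_ge:
  fixes p d L :: real and V :: "'a set"
  assumes p: "0 \<le> p" "p \<le> 1" and V: "finite V" "x \<in> V" and dV: "d = p * card V"
    and L: "1 \<le> L" "10 ^ 9 * L \<le> d" "i \<le> L"
  shows "measure_pmf.prob (Pi_pmf (all_edges V) False (\<lambda>_. bernoulli_pmf p))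
      {f. 1001/1000 * d ^ i \<le> card (explore f i V {x})} \<le> exp (- 5 * L)"
proof -
  \<comment> \<open>The expectation is at most \<open>exp (1.00025 * K)\<close>, while the threshold
    contributes at most \<open>exp (- 1.0008999 * K)\<close>; the gap is about
    \<open>13 * L\<close>, above \<open>5 * L\<close>. Since \<open>K / d\<close> is tiny, even the
    first layer concentrates.\<close>
  define K D l where "K = 20000 * L" and "D = d + 1" and "l = K / D ^ i"
  let ?M = "Pi_pmf (all_edges V) False (\<lambda>_. bernoulli_pmf p)"
  have "1000000000 * L \<le> d" using L(2) by simp
  then have d: "0 < d" using L(1) by linarith
  have K: "0 < K" "K \<le> d / 50000" using L by (auto simp: K_def)
  have D: "1 < D" using d by (simp add: D_def)
  have l: "0 < l" using K D by (simp add: l_def)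
  have lD: "l * D ^ i = K" using D by (simp add: l_def)
  have fin: "finite (all_edges V)" using V by (intro finite_all_edges)
  have eq: "{f. 1001/1000 * d ^ i \<le> card (explore f i V {x})}
      = {f. l * (1001/1000 * d ^ i) \<le> l * card (explore f i V {x})}"
    using l by (simp only: mult_le_cancel_left_pos)
  have "measure_pmf.prob ?M {f. 1001/1000 * d ^ i \<le> card (explore f i V {x})}
      \<le> exp (- (l * (1001/1000 * d ^ i))) *
        measure_pmf.expectation ?M (\<lambda>f. exp (l * card (explore f i V {x})))"
    unfolding eq using fin by (intro prob_ge_le_exp) simp
  also have "\<dots> \<le> exp (- (l * (1001/1000 * d ^ i))) *
      exp (card {x} * (1 / (1 / (l * D ^ i) - 1 / d)))"
  proof (rule mult_left_mono, rule expectation_exp_card_explore_le[OF p d D_def l])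
    show "1 / d < 1 / (l * D ^ i)" unfolding lD using K d by (intro divide_strict_left_mono) auto
  qed (use V dV fin in auto)
  also have "\<dots> \<le> exp (- (l * (1001/1000 * d ^ i))) * exp (K * (1 + 1/4000))"
  proof -
    have "1 \<le> (1 + 1/4000) * (1 - K / d)" using K d by (simp add: field_simps)
    then have "K \<le> K * ((1 + 1/4000) * (1 - K / d))" using K by simp
    moreover have "0 < 1 - K / d" using K d by (simp add: field_simps)
    ultimately have "K / (1 - K / d) \<le> K * (1 + 1/4000)" by (simp add: pos_divide_le_eq mult_ac)
    moreover have "1 / (1 / K - 1 / d) = K / (1 - K / d)" using K d by (simp add: field_simps)
    ultimately have "card {x} * (1 / (1 / (l * D ^ i) - 1 / d)) \<le> K * (1 + 1/4000)"
      by (simp add: lD)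
    then show ?thesis by (intro mult_left_mono) auto
  qed
  also have "\<dots> \<le> exp (- 5 * L)"
  proof -
    have "1 - i / D \<le> (d / D) ^ i"
    proof -
      have "d / D = 1 - 1 / D" using D by (simp add: D_def field_simps)
      then show ?thesis using Bernoulli_inequality[of "- (1 / D)" i] D by simp
    qed
    moreover have "i / D \<le> 1 / 10000"
    proof -
      have "10000 * i \<le> D" using L by (simp add: D_def)
      then show ?thesis using D by (simp add: field_simps)
    qed
    ultimately have "9999 / 10000 \<le> (d / D) ^ i" by linarith
    then have "K * (1001/1000 * (9999 / 10000)) \<le> K * (1001/1000 * (d / D) ^ i)"
      using K by (intro mult_left_mono) auto
    moreover have "K * (1001/1000 * (d / D) ^ i) = l * (1001/1000 * d ^ i)"
      by (simp add: l_def power_divide)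
    ultimately have "K * (1001/1000 * (9999 / 10000)) \<le> l * (1001/1000 * d ^ i)" by (simp only:)
    moreover have "K * (1001/1000 * (9999 / 10000)) = 100089990 / 5000 * L" "K * (1 + 1/4000) = 20005 * L"
      by (simp_all add: K_def)
    ultimately have "- (l * (1001/1000 * d ^ i)) + K * (1 + 1/4000) \<le> - 5 * L"
      using L(1) by linarith
    then show ?thesis by (simp add: exp_add[symmetric])
  qed
  finally show ?thesis .
qed

lemma prob_explore_le:
  fixes p d L :: real and V A :: "'a set"
  assumes p: "0 \<le> p" "p \<le> 1" and V: "finite V" "A \<subseteq> V" and A: "1 \<le> card A" "card A \<le> 2"
    and dV: "d = p * card V"
    and L: "1 \<le> L" "10 ^ 9 * L \<le> d" "i \<le> L" and di: "10 ^ 5 * d ^ i \<le> card V"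
  shows "measure_pmf.prob (Pi_pmf (all_edges V) False (\<lambda>_. bernoulli_pmf p))
      {f. card (explore f i V A) \<le> 999/1000 * card A * d ^ i} \<le> exp (- 5 * L)"
proof -
  \<comment> \<open>With \<open>P\<close> at least 0.9995 against the requested 0.999, the gap is at
    least \<open>K / 2000 = 10 * L\<close>. The trimming term is negligible because
    \<open>999/1000 * K * 2\<close> is far below \<open>3 * K\<close>.\<close>
  define K l where "K = 20000 * L" and "l = K / d ^ i"
  define P where "P = (\<Prod>k\<in>{0<..i}. (1 - 10 * d ^ k / card V) * (1 - K / d ^ k))"
  let ?M = "Pi_pmf (all_edges V) False (\<lambda>_. bernoulli_pmf p)"
  have "1000000000 * L \<le> d" using L(2) by simp
  then have d: "2 \<le> d" "0 < d" using L(1) by linarith+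
  have K: "0 < K" "K \<le> d / 50000" using L by (auto simp: K_def)
  have l: "0 < l" using K d by (simp add: l_def)
  have V0: "0 < real (card V)" using d dV by (cases "card V = 0") auto
  have fin: "finite (all_edges V)" using V by (intro finite_all_edges)
  have small: "10 * d ^ k / card V \<le> 1 \<and> K / d ^ k \<le> 1" if "1 \<le> k" "k \<le> i" for k
  proof
    have "d ^ k \<le> d ^ i" using that d by (intro power_increasing) auto
    then have "10 * d ^ k \<le> 10 ^ 5 * d ^ i" using d by (intro mult_mono) auto
    then have "10 * d ^ k \<le> card V" using di by (rule order_trans)
    then show "10 * d ^ k / card V \<le> 1" using V0 by simp
    have "d ^ 1 \<le> d ^ k" using that d by (intro power_increasing) auto
    then show "K / d ^ k \<le> 1" using K d by (simp add: field_simps)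
  qed
  have P: "9995 / 10000 \<le> P"
  proof -
    define g where "g k = 1 - (1 - 10 * d ^ k / card V) * (1 - K / d ^ k)" for k
    have nn: "0 \<le> 10 * d ^ k / card V" "0 \<le> K / d ^ k" for k using d K by auto
    \<comment> \<open>The product inequality adds up the losses: depletion is a geometric sum
      dominated by the last layer, the second-order terms one dominated by the first.\<close>
    have "1 - sum g {0<..i} \<le> (\<Prod>k\<in>{0<..i}. 1 - g k)"
      using small nn by (intro Weierstrass_prod_ineq) (auto simp: g_def intro!: mult_le_one)
    moreover have "sum g {0<..i} \<le> (\<Sum>k\<in>{0<..i}. 10 / card V * d ^ k + K * (1 / d ^ k))"
    proof (rule sum_mono)
      fix k
      have "g k = 10 * d ^ k / card V + K / d ^ k - (10 * d ^ k / card V) * (K / d ^ k)"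
      proof -
        have "1 - (1 - u) * (1 - v) = u + v - u * v" for u v :: real by (simp add: algebra_simps)
        then show ?thesis unfolding g_def .
      qed
      moreover have "0 \<le> (10 * d ^ k / card V) * (K / d ^ k)" using nn by (intro mult_nonneg_nonneg)
      ultimately show "g k \<le> 10 / card V * d ^ k + K * (1 / d ^ k)" by simp
    qed
    moreover have "\<dots> = 10 / card V * (\<Sum>k\<in>{0<..i}. d ^ k) + K * (\<Sum>k\<in>{0<..i}. 1 / d ^ k)"
      by (simp only: sum.distrib sum_distrib_left)
    moreover have "\<dots> \<le> 10 / card V * (2 * d ^ i) + K * (2 / d)"
      using sum_powers_le[OF d(1), of i] sum_inverse_powers_le[OF d(1), of i] K
      by (intro add_mono mult_left_mono) auto
    moreover have "10 / card V * (2 * d ^ i) \<le> 2 / 10000" using di V0 by (simp add: field_simps)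
    moreover have "K * (2 / d) \<le> 1 / 10000" using K d by (simp add: field_simps)
    ultimately show ?thesis unfolding P_def g_def by simp
  qed
  have eq: "{f. card (explore f i V A) \<le> 999/1000 * card A * d ^ i}
      = {f. - (l * (999/1000 * card A * d ^ i)) \<le> - (l * card (explore f i V A))}"
    using l by (simp only: neg_le_iff_le mult_le_cancel_left_pos)
  have "measure_pmf.prob ?M {f. card (explore f i V A) \<le> 999/1000 * card A * d ^ i}
      \<le> exp (l * (999/1000 * card A * d ^ i)) *
        measure_pmf.expectation ?M (\<lambda>f. exp (- (l * card (explore f i V A))))"
    unfolding eq using prob_ge_le_exp[where M = ?M and X = "\<lambda>f. - (l * card (explore f i V A))"
      and t = "- (l * (999/1000 * card A * d ^ i))"] fin
    by (simp only: minus_minus integrable_Pi_pmf_bool simp_thms)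
  also have "l * (999/1000 * card A * d ^ i) = 999/1000 * K * card A"
    using d by (simp add: l_def)
  also have "exp (999/1000 * K * card A) *
        measure_pmf.expectation ?M (\<lambda>f. exp (- (l * card (explore f i V A))))
      \<le> exp (999/1000 * K * card A) * (exp (- (K / d ^ 0 * P * card A)) + i * exp (- 3 * K))"
  proof (rule mult_left_mono)
    show "measure_pmf.expectation ?M (\<lambda>f. exp (- (l * card (explore f i V A))))
        \<le> exp (- (K / d ^ 0 * P * card A)) + i * exp (- 3 * K)"
      unfolding l_def P_def
    proof (rule expectation_exp_neg_card_explore_le)
      show "3/4 \<le> (\<Prod>k\<in>{0<..i}. (1 - 10 * d ^ k / card V) * (1 - K / d ^ k))"
        using P by (simp add: P_def)
    qed (use p V dV d K small A fin in auto)
  qed simp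
  also have "\<dots> \<le> exp (- 10 * L) + exp (- 10 * L)"
  proof -
    have "exp (999/1000 * K * card A) * exp (- (K / d ^ 0 * P * card A)) \<le> exp (- 10 * L)"
    proof -
      have "K * (1 / 2000) * 1 \<le> K * (P - 999/1000) * card A"
        using P K A by (intro mult_mono mult_nonneg_nonneg) auto
      then show ?thesis by (simp add: exp_add[symmetric] K_def algebra_simps)
    qed
    moreover have "exp (999/1000 * K * card A) * (i * exp (- 3 * K)) \<le> exp (- 10 * L)"
    proof -
      have "999/1000 * K * card A \<le> 999/1000 * K * 2" using A K by (intro mult_left_mono) auto
      moreover have "real i \<le> exp L" using L exp_ge_add_one_self[of L] by linarith
      ultimately have "exp (999/1000 * K * card A) * (i * exp (- 3 * K)) \<le>
          exp (999/1000 * K * 2) * (exp L * exp (- 3 * K))"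
        by (intro mult_mono) auto
      also have "\<dots> = exp (999/1000 * K * 2 + (L - 3 * K))" by (simp only: exp_add[symmetric]) simp
      also have "\<dots> \<le> exp (- 10 * L)" using L by (simp add: K_def)
      finally show ?thesis .
    qed
    ultimately show ?thesis by (simp add: algebra_simps)
  qed
  also have "\<dots> \<le> exp (- 5 * L)"
  proof -
    have "2 \<le> exp (5 * L)" using exp_ge_add_one_self[of "5 * L"] L by linarith
    then have "exp (- 10 * L) * 2 \<le> exp (- 10 * L) * exp (5 * L)" by (intro mult_left_mono) auto
    then show ?thesis by (simp add: exp_add[symmetric])
  qed
  finally show ?thesis .
qed

section \<open>From ball sizes to the number of queries\<close>

text \<open>Adding a last layer matches prolonging a walk by its last edge, and walks starting in
  \<open>A\<close> never leave \<open>V\<close>. A set \<open>A\<close> of two vertices yields the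
  union of two balls.\<close>

lemma explore_eq_balls:
  assumes "E \<subseteq> all_edges V" "A \<subseteq> V"
  shows "explore (\<lambda>e. e \<in> E) i V A = (\<Union>x\<in>A. {y\<in>V. graph_dist E x y \<le> enat i})"
proof -
  have adj: "(x, y) \<in> adj_rel E \<Longrightarrow> y \<in> V" for x y
    using assms by (auto simp: adj_rel_def all_edges_def)
  have "y \<in> explore (\<lambda>e. e \<in> E) i V A \<longleftrightarrow> (\<exists>x\<in>A. \<exists>k\<le>i. (x, y) \<in> adj_rel E ^^ k)" for y
  proof (induction i arbitrary: y)
    case (Suc i)
    have "y \<in> explore (\<lambda>e. e \<in> E) (Suc i) V A \<longleftrightarrow> y \<in> explore (\<lambda>e. e \<in> E) i V A \<or>
        (\<exists>z. z \<in> explore (\<lambda>e. e \<in> E) i V A \<and> (z, y) \<in> adj_rel E)"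
      unfolding explore_Suc_eq[OF assms(2)] using adj by (auto simp: neighbours_in_def adj_rel_def)
    also have "\<dots> \<longleftrightarrow> (\<exists>x\<in>A. \<exists>k\<le>Suc i. (x, y) \<in> adj_rel E ^^ k)"
      unfolding Suc.IH
    proof
      assume "(\<exists>x\<in>A. \<exists>k\<le>Suc i. (x, y) \<in> adj_rel E ^^ k)"
      then obtain x k where "x \<in> A" "k \<le> Suc i" "(x, y) \<in> adj_rel E ^^ k" by blast
      then show "(\<exists>x\<in>A. \<exists>k\<le>i. (x, y) \<in> adj_rel E ^^ k) \<or>
          (\<exists>z. (\<exists>x\<in>A. \<exists>k\<le>i. (x, z) \<in> adj_rel E ^^ k) \<and> (z, y) \<in> adj_rel E)"
      proof (cases "k \<le> i")
        case False
        then have "(x, y) \<in> adj_rel E ^^ Suc i"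
          using \<open>k \<le> Suc i\<close> \<open>(x, y) \<in> adj_rel E ^^ k\<close> by (simp only: le_Suc_eq simp_thms)
        then obtain z where "(x, z) \<in> adj_rel E ^^ i" "(z, y) \<in> adj_rel E"
          by (rule relpow_Suc_E)
        then show ?thesis using \<open>x \<in> A\<close> by blast
      qed (use \<open>x \<in> A\<close> \<open>(x, y) \<in> adj_rel E ^^ k\<close> in blast)
    qed (meson le_SucI Suc_le_mono relpow_Suc_I)
    finally show ?case .
  qed auto
  then have "explore (\<lambda>e. e \<in> E) i V A = {y. \<exists>x\<in>A. graph_dist E x y \<le> enat i}"
    by (simp add: graph_dist_le_iff set_eq_iff)
  moreover have "explore (\<lambda>e. e \<in> E) i V A \<subseteq> V" by (rule explore_subset[OF assms(2)])
  ultimately show ?thesis by auto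
qed

text \<open>For \<open>x = y\<close> the hypothesis \<open>lower\<close> bounds a single ball. For
  distinct vertices, inclusion-exclusion leaves at most
  \<open>2 * 1001/1000 * s - 2 * 999/1000 * s\<close> for the intersection. Nothing random remains
  here.\<close>

lemma pq_le_of_ball_sizes:
  fixes s :: real
  assumes V: "finite V" "V \<noteq> {}" and E: "E \<subseteq> all_edges V"
    and upper: "\<And>x. x \<in> V \<Longrightarrow> card (explore (\<lambda>e. e \<in> E) i V {x}) \<le> 1001/1000 * s"
    and lower: "\<And>x y. x \<in> V \<Longrightarrow> y \<in> V \<Longrightarrow>
      999/1000 * card {x, y} * s \<le> card (explore (\<lambda>e. e \<in> E) i V {x, y})"
    and s: "0 < s" "10 ^ 5 * s \<le> card V" and L: "1 \<le> ln (card V)"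
  shows "pq V E \<le> 2 * (card V * ln (card V) / s)"
proof -
  define S where "S x = {y\<in>V. graph_dist E x y \<le> enat i}" for x
  define \<theta> where "\<theta> = 3/5 * s / card V"
  have fS: "finite (S x)" for x using V by (simp add: S_def)
  have ball: "explore (\<lambda>e. e \<in> E) i V {x} = S x" if "x \<in> V" for x
    using explore_eq_balls[OF E, of "{x}" i] that by (simp add: S_def)
  have union: "explore (\<lambda>e. e \<in> E) i V {x, y} = S x \<union> S y" if "x \<in> V" "y \<in> V" for x y
    using explore_eq_balls[OF E, of "{x, y}" i] that by (simp add: S_def)
  have V0: "0 < real (card V)" using V by (simp add: card_gt_0_iff)
  have \<theta>: "0 < \<theta>" "\<theta> \<le> 1" using s V0 by (auto simp: \<theta>_def field_simps)
  have shrink: "\<exists>u\<in>V. \<exists>v\<in>V. card (survivors E W u v) \<le> (1 - \<theta>) * card W \<and>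
      card (survivors E W v u) \<le> (1 - \<theta>) * card W" if W: "W \<subseteq> V" "1000 \<le> card W" for W
  proof -
    have fW: "finite W" using W V finite_subset by blast
    have "\<exists>u\<in>V. \<exists>v\<in>V. 3/5 * s * card W / card V \<le> card (W \<inter> (S u - S v)) \<and>
           3/5 * s * card W / card V \<le> card (W \<inter> (S v - S u))"
    proof (rule balanced_pair_exists[OF V(1) W(1)])
      show "999/1000 * s \<le> card (S x)" if "x \<in> V" for x
        using lower[OF that that] ball[OF that] by simp
      show up: "card (S x) \<le> 1001/1000 * s" if "x \<in> V" for x
        using upper[OF that] ball[OF that] by simp
      show "card (S x \<inter> S y) \<le> 4/1000 * s" if "x \<in> V" "y \<in> V" "x \<noteq> y" for x y
      proof -
        have "card (S x) + card (S y) = card (S x \<union> S y) + card (S x \<inter> S y)"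
          by (rule card_Un_Int[OF fS fS])
        then have "real (card (S x)) + real (card (S y)) = real (card (S x \<union> S y)) + real (card (S x \<inter> S y))"
          by (metis of_nat_add)
        then show ?thesis using lower[OF that(1,2)] union[OF that(1,2)] up[OF that(1)] up[OF that(2)] that
          by simp
      qed
    qed (use s W graph_dist_commute[of E] in \<open>auto simp: S_def\<close>)
    then obtain u v where uv: "u \<in> V" "v \<in> V" "\<theta> * card W \<le> card (W \<inter> (S u - S v))"
      "\<theta> * card W \<le> card (W \<inter> (S v - S u))" by (auto simp: \<theta>_def)
    have surv: "card (survivors E W a b) \<le> (1 - \<theta>) * card W"
      if "\<theta> * card W \<le> card (W \<inter> (S b - S a))" for a b
    proof -
      have "W \<inter> (S b - S a) = {x\<in>W. graph_dist E b x \<le> enat i \<and> \<not> graph_dist E a x \<le> enat i}"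
        using W by (auto simp: S_def)
      then have "card (survivors E W a b) + card (W \<inter> (S b - S a)) \<le> card W"
        using card_survivors_le[OF fW, of E a b i] by simp
      then have "real (card (survivors E W a b)) + real (card (W \<inter> (S b - S a))) \<le> real (card W)"
        by (metis of_nat_add of_nat_le_iff)
      then show ?thesis using that by (simp add: algebra_simps)
    qed
    show ?thesis using uv surv[of u v] surv[of v u] by blast
  qed
  have rounds: "pq V E \<le> 1000 + nat \<lceil>ln (card V) / \<theta>\<rceil>"
    by (rule pq_le_of_shrinking_queries[OF V \<theta> _ shrink]) auto
  have "real (pq V E) \<le> 1001 + ln (card V) / \<theta>"
  proof -
    have "0 \<le> ln (card V) / \<theta>" using L \<theta> by simp
    then have "real (nat \<lceil>ln (card V) / \<theta>\<rceil>) \<le> ln (card V) / \<theta> + 1" by linarith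
    then show ?thesis using rounds by linarith
  qed
  also have "ln (card V) / \<theta> = 5/3 * (card V * ln (card V) / s)"
    using s V0 by (simp add: \<theta>_def)
  \<comment> \<open>The final queries and the rounding fit into the gap between 5/3 and 2, since
    \<open>card V * ln (card V) / s\<close> is at least \<open>10 ^ 5\<close>.\<close>
  also have "1001 \<le> 1/3 * (card V * ln (card V) / s)"
  proof -
    have "10 ^ 5 * s * 1 \<le> card V * ln (card V)" using s L by (intro mult_mono) auto
    then show ?thesis using s by (simp add: field_simps)
  qed
  finally show ?thesis by simp
qed

text \<open>A union bound over \<open>n\<close> balls and \<open>n ^ 2\<close> ordered pairs, each
  failing with probability at most \<open>1 / n ^ 5\<close>. The diagonal pairs supply the lower
  bound for single balls.\<close>

lemma prob_gnp_pq_le: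
  fixes p d :: real
  assumes p: "0 \<le> p" "p \<le> 1" and d: "d = p * real n" "10 ^ 9 * ln (real n) \<le> d"
    and L: "1 \<le> ln (real n)" and di: "10 ^ 5 * d ^ i \<le> real n"
  shows "1 - 2 / real n \<le> measure_pmf.prob (gnp n p)
    {E. pq {1..n} E \<le> 2 * (real n * ln (real n) / d ^ i)}"
proof -
  define V M where "V = {1..n}" and "M = Pi_pmf (all_edges V) False (\<lambda>_. bernoulli_pmf p)"
  define G where "G f = {e \<in> all_edges V. f e}" for f :: "nat set \<Rightarrow> bool"
  define B1 where "B1 x = {f. 1001/1000 * d ^ i \<le> card (explore f i V {x})}" for x
  define B2 where "B2 z = {f. card (explore f i V {fst z, snd z})
      \<le> 999/1000 * card {fst z, snd z} * d ^ i}" for z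
  have n: "1 \<le> n" using L by (cases n) auto
  have V: "finite V" "V \<noteq> {}" "card V = n" using n by (auto simp: V_def)
  have "1000000000 * ln n \<le> d" using d(2) by simp
  then have d0: "0 < d" "exp 1 \<le> d" using L exp_le by linarith+
  \<comment> \<open>The tail bounds are applied with \<open>L = ln n\<close>; the number of layers
    obeys it because \<open>d\<close> is at least e and \<open>d ^ i\<close> at most
    \<open>n\<close>.\<close>
  have iL: "real i \<le> ln n"
  proof -
    have "ln (d ^ i) \<le> ln n"
    proof (rule ln_mono)
      have "1 * d ^ i \<le> 10 ^ 5 * d ^ i" using d0 by (intro mult_right_mono) auto
      then show "d ^ i \<le> n" using di by linarith
    qed (use d0 n in auto)
    moreover have "1 \<le> ln d" using d0 by (simp add: ln_ge_iff)
    then have "real i * 1 \<le> real i * ln d" by (intro mult_left_mono) auto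
    ultimately show ?thesis using d0 by (simp add: ln_realpow)
  qed
  have e5: "exp (- 5 * ln n) = 1 / real n ^ 5"
  proof -
    have "exp (5 * ln n) = real n ^ 5"
      using n exp_of_nat_mult[of 5 "ln (real n)"] by simp
    then show ?thesis by (simp add: exp_minus inverse_eq_divide)
  qed
  have p1: "measure_pmf.prob M (B1 x) \<le> 1 / real n ^ 5" if "x \<in> V" for x
    unfolding M_def B1_def e5[symmetric]
    by (rule prob_explore_ge) (use p V d L iL that in auto)
  have p2: "measure_pmf.prob M (B2 z) \<le> 1 / real n ^ 5" if "z \<in> V \<times> V" for z
    unfolding M_def B2_def e5[symmetric]
    by (rule prob_explore_le) (use p V d L iL di that in \<open>auto simp: card_insert_if\<close>)
  have good: "pq V (G f) \<le> 2 * (real n * ln (real n) / d ^ i)"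
    if f: "f \<notin> (\<Union>x\<in>V. B1 x) \<union> (\<Union>z\<in>V \<times> V. B2 z)" for f
  proof -
    have eq: "explore (\<lambda>e. e \<in> G f) i V A = explore f i V A" if "A \<subseteq> V" for A
      using that by (intro explore_cong) (auto simp: G_def)
    show ?thesis unfolding V(3)[symmetric]
    proof (rule pq_le_of_ball_sizes[OF V(1,2)])
      show "G f \<subseteq> all_edges V" by (auto simp: G_def)
      show "card (explore (\<lambda>e. e \<in> G f) i V {x}) \<le> 1001/1000 * d ^ i" if "x \<in> V" for x
        using f that by (auto simp: B1_def eq)
      show "999/1000 * card {x, y} * d ^ i \<le> card (explore (\<lambda>e. e \<in> G f) i V {x, y})"
        if "x \<in> V" "y \<in> V" for x y
      proof -
        have "f \<notin> B2 (x, y)" using f that by auto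
        then show ?thesis using that by (simp add: B2_def eq)
      qed
    qed (use d0 di L V in auto)
  qed
  let ?Q = "{f. pq V (G f) \<le> 2 * (real n * ln (real n) / d ^ i)}"
  have "measure_pmf.prob M (- ?Q) \<le> measure_pmf.prob M ((\<Union>x\<in>V. B1 x) \<union> (\<Union>z\<in>V \<times> V. B2 z))"
    using good by (intro measure_pmf.finite_measure_mono) auto
  also have "\<dots> \<le> measure_pmf.prob M (\<Union>x\<in>V. B1 x) + measure_pmf.prob M (\<Union>z\<in>V \<times> V. B2 z)"
    by (rule measure_Un_le) auto
  also have "\<dots> \<le> (\<Sum>x\<in>V. measure_pmf.prob M (B1 x)) + (\<Sum>z\<in>V \<times> V. measure_pmf.prob M (B2 z))"
    using V by (intro add_mono measure_pmf.finite_measure_subadditive_finite) auto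
  also have "\<dots> \<le> (\<Sum>x\<in>V. 1 / real n ^ 5) + (\<Sum>z\<in>V \<times> V. 1 / real n ^ 5)"
    using p1 p2 by (intro add_mono sum_mono)
  also have "\<dots> = 1 / real n ^ 4 + 1 / real n ^ 3"
    using n V by (simp add: card_cartesian_product field_simps power_numeral_reduce)
  also have "\<dots> \<le> 1 / real n + 1 / real n"
  proof -
    have "real n \<le> real n ^ 4" "real n \<le> real n ^ 3" using n by (auto intro: self_le_power)
    then show ?thesis using n by (intro add_mono divide_left_mono) auto
  qed
  finally have "1 - 2 / real n \<le> measure_pmf.prob M ?Q"
    using measure_pmf.prob_compl[of ?Q M] by (simp add: Compl_eq_Diff_UNIV)
  then show ?thesis
    by (simp add: gnp_def measure_map_pmf vimage_def M_def G_def V_def)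
qed

theorem theorem3p4:
  fixes p d \<omega> :: "nat \<Rightarrow> real" and i :: "nat \<Rightarrow> nat"
  assumes "\<And>n. 0 \<le> p n \<and> p n \<le> 1"
    and "\<And>n. d n = p n * real n"
    and "filterlim \<omega> at_top sequentially"
    and "\<forall>\<^sub>F n in sequentially. \<omega> n \<le> ln (real n)"
    and "\<forall>\<^sub>F n in sequentially. \<omega> n * ln (real n) \<le> d n \<and> d n \<le> real n / \<omega> n"
    and "largest_exponent d i"
    and "filterlim (\<lambda>n. d n ^ (i n + 1) / real n - 2 * ln (real n)) at_top sequentially"
  shows "\<exists>\<epsilon> :: nat \<Rightarrow> real. \<epsilon> \<longlonglongrightarrow> 0 \<and>
    aas p (\<lambda>n E. real (pq {1..n} E) \<le> (2 + \<epsilon> n) * (real n * ln (real n) / d n ^ i n)) \<and>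
    (\<lambda>n. (2 + \<epsilon> n) * (real n * ln (real n) / d n ^ i n))
      \<in> O(\<lambda>n. real n * ln (real n) / d n ^ i n)"
proof (intro exI[of _ "\<lambda>_. 0"] conjI)
  \<comment> \<open>The slack in 5/3 lets \<open>\<epsilon>\<close> be zero, so the asymptotic
    assumptions enter only through fixed constants that hold eventually.\<close>
  have "\<forall>\<^sub>F n in sequentially. 1 \<le> ln (real n)"
    using filterlim_compose[OF ln_at_top filterlim_real_sequentially] by (simp add: filterlim_at_top)
  moreover have "\<forall>\<^sub>F n in sequentially. 10 ^ 9 \<le> \<omega> n"
    using assms(3) by (simp add: filterlim_at_top)
  moreover have "\<forall>\<^sub>F n in sequentially. norm (d n ^ i n) \<le> 1 / 10 ^ 5 * norm (real n)"
    using assms(6) unfolding largest_exponent_def by (intro landau_o.smallD) auto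
  ultimately have ev: "\<forall>\<^sub>F n in sequentially. 1 - 2 / real n \<le> measure_pmf.prob (gnp n (p n))
      {E. pq {1..n} E \<le> 2 * (real n * ln (real n) / d n ^ i n)}"
    using assms(5)
  proof eventually_elim
    case (elim n)
    show ?case
    proof (rule prob_gnp_pq_le)
      have "10 ^ 9 * ln (real n) \<le> \<omega> n * ln (real n)" using elim by (intro mult_right_mono) auto
      then show "10 ^ 9 * ln (real n) \<le> d n" using elim by linarith
      show "10 ^ 5 * d n ^ i n \<le> real n" using elim by simp
    qed (use elim assms(1,2) in auto)
  qed
  have lim: "(\<lambda>n. 1 - 2 / real n) \<longlonglongrightarrow> 1"
    using tendsto_diff[OF tendsto_const lim_const_over_n[of "2 :: real"], of 1] by simp
  show "aas p (\<lambda>n E. real (pq {1..n} E) \<le> (2 + 0) * (real n * ln (real n) / d n ^ i n))"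
    unfolding aas_def add_0_right
    by (rule tendsto_sandwich[OF ev _ lim tendsto_const]) simp
  show "(\<lambda>n. (2 + 0) * (real n * ln (real n) / d n ^ i n)) \<in> O(\<lambda>n. real n * ln (real n) / d n ^ i n)"
    by (rule bigoI[where c = 2]) (simp add: abs_mult)
qed simp

end
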